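(* Let $n,m,k$ be positive integers with $k\ge n$, let $N_0>0$, and let $\mathbf{H}\in\mathbb{C}^{n\times k}$ be a fixed matrix such that $\mathbf{H}\mathbf{H}^\dagger$ is positive definite. Let $N_0<y_1\le y_2\le\dots\le y_n<\infty$ denote the eigenvalues of $\mathbf{H}\mathbf{H}^\dagger+N_0\mathbf{I}_n$. For an $n\times m$ random matrix $\mathbf{X}$ put $$W(\mathbf{X})=\frac{\frac1n\operatorname{Tr}(\mathbf{X}\mathbf{X}^\dagger)}{\det(\mathbf{X}\mathbf{X}^\dagger)^{1/n}},$$ and let $W_0=W(\mathbf{X})$ with $\mathbf{X}\sim\mathcal{CN}_{n,m}(\mathbf{0},N_0\mathbf{I}_n)$ and $W_1=W(\mathbf{X})$ with $\mathbf{X}\sim\mathcal{CN}_{n,m}(\mathbf{0},\mathbf{H}\mathbf{H}^\dagger+N_0\mathbf{I}_n)$. Then for every positive integer $p$ with $p<n(m-n+1)$, $$\mathrm{E}[W_0^p]=\frac{\Gamma(mn)}{n^p\,\Gamma(mn-p)}\prod_{j=0}^{n-1}\frac{\Gamma\left(m-n+1-\frac pn+j\right)}{\Gamma(m-n+1+j)},$$ $$\mathrm{E}[W_1^p]=\frac{p!\,\prod_{i=1}^n y_i^{-p/n}}{n^p}\prod_{j=0}^{n-1}\frac{\Gamma\left(m-n+1-\frac pn+j\right)}{\Gamma(m-n+1+j)}\sum_{k_1+\dots+k_n=p}\ \prod_{i=1}^n\frac{\Gamma\left(m-\frac pn+k_i\right)y_i^{k_i}}{\Gamma(k_i+1)\,\Gamma\left(m-\frac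 pn\right)},$$ where the sum is over all tuples of nonnegative integers $(k_1,\dots,k_n)$ with $k_1+\dots+k_n=p$.
   Context: $\mathbf{X}\sim\mathcal{CN}_{n,m}(\mathbf{0},\mathbf{R})$ means that $\mathbf{X}$ is an $n\times m$ random matrix whose $m$ columns are independent circularly symmetric complex Gaussian vectors in $\mathbb{C}^n$ with mean zero and covariance matrix $\mathbf{R}$. $\dagger$ denotes conjugate transpose, $\mathbf{I}_n$ the identity matrix, and $\Gamma$ the Gamma function. *)

theory Defs
  imports "HOL-Probability.Probability"
begin

definition cadjoint :: "complex^'n^'m \<Rightarrow> complex^'m^'n"
  where "cadjoint A = (\<chi> i j. cnj (A $ j $ i))"

definition herm_form :: "complex^'n^'n \<Rightarrow> complex^'n \<Rightarrow> complex"
  where "herm_form A z = (\<Sum>i\<in>UNIV. cnj (z $ i) * (A *v z) $ i)"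

(* herm_form A z is real for Hermitian A, so Re loses nothing here or below. *)
definition positive_definite :: "complex^'n^'n \<Rightarrow> bool"
  where "positive_definite A \<longleftrightarrow> cadjoint A = A \<and> (\<forall>z. z \<noteq> 0 \<longrightarrow> 0 < Re (herm_form A z))"

(* y 1, ..., y n are the eigenvalues of A, repeated according to their multiplicity as
   roots of the characteristic polynomial, in nondecreasing order; "mat x" is x times
   the identity matrix. *)
definition ordered_eigenvalues :: "complex^'n^'n \<Rightarrow> (nat \<Rightarrow> real) \<Rightarrow> bool"
  where "ordered_eigenvalues A y \<longleftrightarrow>
    mono_on {1..CARD('n)} y \<and>
    (\<forall>x. det (mat x - A) = (\<Prod>i = 1..CARD('n). x - complex_of_real (y i)))"

(* Density of the circularly symmetric complex Gaussian vector with mean 0 and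
   nonsingular covariance matrix R = E[z z^*]:
   exp (- z^* R^(-1) z) / (pi^n det R), with respect to Lebesgue measure on
   C^n = R^(2n) (lborel on complex^'n).  In the scalar case R = (r), the real and
   imaginary parts are independent, centred and of variance r/2 each. *)
definition complex_normal_density :: "complex^'n^'n \<Rightarrow> complex^'n \<Rightarrow> real"
  where "complex_normal_density R z =
    exp (- Re (herm_form (matrix_inv R) z)) / (pi ^ CARD('n) * Re (det R))"

(* X ~ CN(0, R).  Positive definiteness of R is required, since otherwise the law of
   the columns has no density. *)
definition complex_normal_matrix ::
    "'a measure \<Rightarrow> ('a \<Rightarrow> complex^'m^'n) \<Rightarrow> complex^'n^'n \<Rightarrow> bool"
  where "complex_normal_matrix M X R \<longleftrightarrow>
    positive_definite R \<and>
    prob_space.indep_vars M (\<lambda>_. borel) (\<lambda>j \<omega>. column j (X \<omega>)) UNIV \<and>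
    (\<forall>j. distributed M lborel (\<lambda>\<omega>. column j (X \<omega>)) (\<lambda>z. ennreal (complex_normal_density R z)))"

(* Trace and determinant of X X^* are nonnegative reals.  W is 0 where the determinant
   vanishes, which is a null event for Gaussian X with n <= m. *)
definition sphericity_ratio :: "complex^'m^'n \<Rightarrow> real"
  where "sphericity_ratio X =
    (1 / real CARD('n) * Re (trace (X ** cadjoint X))) /
    Re (det (X ** cadjoint X)) powr (1 / real CARD('n))"

end

theory Submission
  imports Defs
begin

text \<open>With \<open>s = p / n\<close>, the \<open>p\<close>-th power of the ratio is, up to the constant \<open>n ^ p\<close>, the \<open>p\<close>-th power of the trace of the Gram matrix
\<open>X ** cadjoint X\<close> times its determinant to the power \<open>- s\<close>. The weight by the determinant turns the
Wishart law of the Gram matrix into a Wishart law with the fractional number \<open>m - s\<close> of degrees of freedom. Under such a law the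
trace is distributed as a sum of independent Gamma variables with scales \<open>y i\<close>, and the theorem reads off its moments.
The proof carries out this idea on the level of the Gaussian matrix, without densities on the cone of positive definite matrices.

The integral of \<open>det (X ** cadjoint X) powr - s\<close> against a Gaussian weight with inverse covariance \<open>A\<close> is a constant times a power of
\<open>det A\<close> (\<open>nn_integral_det_powr_gaussian\<close>). The dependence on \<open>A\<close> comes from a linear substitution, which is a product
of elementary row operations obtained by completing squares (\<open>positive_definite_factorization\<close>). The constant comes from adding the rows of
\<open>X\<close> one at a time: the Gram determinant is multiplied by the squared distance of the new row to the span of the
previous ones (\<open>det_gram_insert\<close>), and for a Gaussian row the negative moments of that distance depend only on the
codimension (\<open>nn_integral_residual_powr\<close>). This is the origin of the product of Gamma ratios.

Choosing \<open>A\<close> as the inverse covariance minus \<open>\<tau>\<close> times the identity yields the generating function of the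
weighted moments of the trace, in terms of the characteristic polynomial of the covariance
(\<open>complex_normal_moment_generating\<close>). Its expansion in powers of \<open>\<tau>\<close> determines the moments
(\<open>nn_integral_moment_eq_coeff\<close>). For a multiple of the identity it is a single binomial series, which gives the first formula;
in general it is a product of \<open>n\<close> binomial series, and the sum over tuples is the coefficient of their product.\<close>

section \<open>Negative powers of the distance to a subspace\<close>

lemma nn_integral_lborel_affine:
  fixes f :: "'v::euclidean_space \<Rightarrow> ennreal" and t :: 'v
  assumes [measurable]: "f \<in> borel_measurable borel" and "c \<noteq> 0"
  shows "(\<integral>\<^sup>+x. f x \<partial>lborel) = ennreal (\<bar>c\<bar> ^ DIM('v)) * (\<integral>\<^sup>+x. f (t + c *\<^sub>R x) \<partial>lborel)"
  by (subst lborel_affine[OF \<open>c \<noteq> 0\<close>, of t], subst nn_integral_density, measurable,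
      subst nn_integral_distr, measurable, subst nn_integral_cmult, measurable)

text \<open>This is the bridge between negative powers and exponentials: up to the factor \<open>Gamma s\<close>, the number
\<open>c powr - s\<close> is an average of the exponentials \<open>exp (- c * t)\<close>, and exponentials of quadratic forms can be
integrated explicitly.\<close>
lemma nn_integral_Gamma_scaled:
  fixes s c :: real
  assumes "0 < s" "0 < c"
  shows "(\<integral>\<^sup>+t. indicator {0..} t * ennreal (t powr (s - 1) * exp (- c * t)) \<partial>lborel)
    = ennreal (Gamma s * c powr - s)"
proof -
  have "ennreal (Gamma s) = (\<integral>\<^sup>+t. ennreal (indicator {0..} t * t powr (s - 1) / exp t) \<partial>lborel)"
    using Gamma_conv_nn_integral_real[OF \<open>0 < s\<close>] .
  also have "\<dots> = ennreal c * (\<integral>\<^sup>+t. ennreal (indicator {0..} (c * t) * (c * t) powr (s - 1) / exp (c * t)) \<partial>lborel)"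
    using nn_integral_real_affine[of "\<lambda>t. ennreal (indicator {0..} t * t powr (s - 1) / exp t)" c 0] assms
    by simp
  also have "\<dots> = ennreal c * (\<integral>\<^sup>+t. ennreal (c powr (s - 1)) *
      (indicator {0..} t * ennreal (t powr (s - 1) * exp (- c * t))) \<partial>lborel)"
    using assms
    by (intro arg_cong2[where f="(*)"] refl nn_integral_cong)
       (auto simp: indicator_def powr_mult exp_minus field_simps zero_le_mult_iff simp flip: ennreal_mult')
  also have "\<dots> = ennreal (c powr s) *
      (\<integral>\<^sup>+t. indicator {0..} t * ennreal (t powr (s - 1) * exp (- c * t)) \<partial>lborel)"
    using assms
    by (subst nn_integral_cmult) (auto simp: powr_mult_base simp flip: mult.assoc ennreal_mult')
  finally have "ennreal (c powr - s) * ennreal (Gamma s) = ennreal (c powr - s) * (ennreal (c powr s) *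
      (\<integral>\<^sup>+t. indicator {0..} t * ennreal (t powr (s - 1) * exp (- c * t)) \<partial>lborel))"
    by simp
  then show ?thesis
    using assms by (simp flip: mult.assoc ennreal_mult' powr_add add: mult.commute)
qed

lemma nn_integral_exp_square:
  fixes c a :: real
  assumes "0 < c"
  shows "(\<integral>\<^sup>+x. ennreal (exp (- c * (x - a)\<^sup>2)) \<partial>lborel) = ennreal (sqrt (pi / c))"
proof -
  let ?\<sigma> = "sqrt (1 / (2 * c))"
  have \<sigma>: "?\<sigma>\<^sup>2 = 1 / (2 * c)" "0 < ?\<sigma>" using assms by auto
  have "exp (- c * (x - a)\<^sup>2) = sqrt (pi / c) * normal_density a ?\<sigma> x" for x
    unfolding normal_density_def \<sigma> using assms by (simp add: mult.commute)
  moreover have "(\<integral>\<^sup>+x. ennreal (normal_density a ?\<sigma> x) \<partial>lborel) = 1"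
    using \<sigma>(2) by (subst nn_integral_eq_integral) auto
  ultimately show ?thesis
    using assms by (simp add: ennreal_mult' nn_integral_cmult)
qed

lemma sqrt_power_eq_powr:
  assumes "0 < x"
  shows "sqrt x ^ d = x powr (d / 2)"
proof -
  have "sqrt x ^ d = (x powr (1 / 2)) powr d"
    using assms by (simp add: powr_realpow powr_half_sqrt)
  then show ?thesis by (simp only: powr_powr) simp
qed

lemma nn_integral_exp_norm_square:
  fixes c :: real and a :: "'v::euclidean_space"
  assumes "0 < c"
  shows "(\<integral>\<^sup>+x. ennreal (exp (- c * (norm (x - a))\<^sup>2)) \<partial>lborel) = ennreal ((pi / c) powr (DIM('v) / 2))"
proof -
  have "exp (- c * (norm (x - a))\<^sup>2) = (\<Prod>b\<in>Basis. exp (- c * (x \<bullet> b - a \<bullet> b)\<^sup>2))" for x :: 'v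
    unfolding power2_norm_eq_inner
    by (subst euclidean_inner) (simp add: exp_sum[symmetric] inner_diff_left sum_distrib_left power2_eq_square sum_negf)
  then have "(\<integral>\<^sup>+x. ennreal (exp (- c * (norm (x - a))\<^sup>2)) \<partial>lborel) =
      (\<integral>\<^sup>+x. (\<Prod>b\<in>Basis. ennreal (exp (- c * (x \<bullet> b - a \<bullet> b)\<^sup>2))) \<partial>lborel)"
    by (simp add: prod_ennreal)
  also have "\<dots> = (\<Prod>b\<in>(Basis :: 'v set). \<integral>\<^sup>+x. ennreal (exp (- c * (x - a \<bullet> b)\<^sup>2)) \<partial>lborel)"
    by (rule nn_integral_lborel_prod[of "\<lambda>b x. ennreal (exp (- c * (x - a \<bullet> b)\<^sup>2))"]) auto
  also have "\<dots> = ennreal ((pi / c) powr (DIM('v) / 2))"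
    unfolding nn_integral_exp_square[OF assms]
    using assms sqrt_power_eq_powr[of "pi / c"] by (simp add: ennreal_power)
  finally show ?thesis .
qed

definition orthonormal :: "'v::euclidean_space set \<Rightarrow> bool"
  where "orthonormal B \<longleftrightarrow> pairwise orthogonal B \<and> (\<forall>b\<in>B. norm b = 1)"

text \<open>For orthonormal \<open>B\<close> this is the squared distance from \<open>y\<close> to the span of \<open>B\<close>.\<close>
definition residual_square :: "'v::euclidean_space set \<Rightarrow> 'v \<Rightarrow> real"
  where "residual_square B y = (norm y)\<^sup>2 - (\<Sum>b\<in>B. (y \<bullet> b)\<^sup>2)"

lemma orthonormal_finite: "orthonormal B \<Longrightarrow> finite B"
  unfolding orthonormal_def by (auto intro!: pairwise_orthogonal_imp_finite)

lemma orthonormal_inner: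
  assumes "orthonormal B" "a \<in> B" "b \<in> B"
  shows "a \<bullet> b = (if a = b then 1 else 0)"
  using assms unfolding orthonormal_def pairwise_def orthogonal_def
  by (auto simp: norm_eq_1)

lemma orthonormal_inner_sum:
  assumes B: "orthonormal B" and "b \<in> B"
  shows "(\<Sum>a\<in>B. c a *\<^sub>R a) \<bullet> b = c b"
proof -
  have "(\<Sum>a\<in>B. c a *\<^sub>R a) \<bullet> b = (\<Sum>a\<in>B. if a = b then c a else 0)"
    unfolding inner_sum_left using assms by (intro sum.cong refl) (simp add: orthonormal_inner)
  then show ?thesis using assms orthonormal_finite[OF B] by simp
qed

lemma orthonormal_norm_sum:
  assumes B: "orthonormal B"
  shows "(norm (\<Sum>b\<in>B. c b *\<^sub>R b))\<^sup>2 = (\<Sum>b\<in>B. (c b)\<^sup>2)"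
  unfolding power2_norm_eq_inner inner_sum_right
  by (intro sum.cong refl) (simp add: orthonormal_inner_sum[OF B] power2_eq_square)

text \<open>Pythagoras: the component of \<open>y\<close> orthogonal to the span of \<open>B\<close> is not affected by moving within the span.\<close>
lemma norm_diff_orthonormal_sum:
  assumes B: "orthonormal B"
  shows "(norm (y - (\<Sum>b\<in>B. c b *\<^sub>R b)))\<^sup>2 = residual_square B y + (\<Sum>b\<in>B. (c b - y \<bullet> b)\<^sup>2)"
proof -
  have "(norm (y - (\<Sum>b\<in>B. c b *\<^sub>R b)))\<^sup>2 =
      (norm y)\<^sup>2 - 2 * (y \<bullet> (\<Sum>b\<in>B. c b *\<^sub>R b)) + (\<Sum>b\<in>B. (c b)\<^sup>2)"
    unfolding orthonormal_norm_sum[OF B, symmetric] power2_norm_eq_inner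
    by (simp add: inner_diff_left inner_diff_right inner_commute)
  then show ?thesis
    by (simp add: residual_square_def power2_diff sum.distrib sum_subtractf inner_sum_right
        sum_distrib_left sum_negf mult_ac)
qed

lemma residual_square_nonneg:
  assumes "orthonormal B"
  shows "0 \<le> residual_square B y"
  using norm_diff_orthonormal_sum[OF assms, of y "\<lambda>b. y \<bullet> b"] by (simp add: sum_nonneg)
     (metis zero_le_power2)

lemma residual_square_eq_0:
  assumes "orthonormal B" "residual_square B y = 0"
  shows "y \<in> span B"
proof -
  have "y = (\<Sum>b\<in>B. (y \<bullet> b) *\<^sub>R b)"
    using norm_diff_orthonormal_sum[OF assms(1), of y "\<lambda>b. y \<bullet> b"] assms(2) by simp
  also have "\<dots> \<in> span B" by (intro span_sum span_scale span_base)
  finally show ?thesis .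
qed

text \<open>The quadratic form in the exponent would be diagonal in an orthonormal basis extending \<open>B\<close>. To avoid the
rotation of the Lebesgue measure that such a basis requires, the exponential of the residual is
written as a Gaussian integral over the span of \<open>B\<close>: up to a constant, \<open>exp (- t * residual_square B y)\<close> is the
integral of \<open>exp (- t * (norm (y - v))\<^sup>2)\<close> over all \<open>v\<close> in the span. After exchanging the two integrations,
the integral over \<open>y\<close> is an isotropic Gaussian integral, by completing the square, and what
remains is again a Gaussian integral over the span.\<close>
lemma nn_integral_exp_residual:
  fixes B :: "'v::euclidean_space set" and t :: real
  assumes B: "orthonormal B" and t: "0 < t"
  shows "(\<integral>\<^sup>+y. ennreal (exp (- (norm y)\<^sup>2 - t * residual_square B y)) \<partial>lborel)
    = ennreal (pi powr (DIM('v) / 2) * (1 + t) powr (- ((real (DIM('v)) - real (card B)) / 2)))"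
proof -
  interpret product_sigma_finite "\<lambda>b::'v. lborel :: real measure" ..
  note fin[simp] = orthonormal_finite[OF B]
  interpret C: sigma_finite_measure "PiM B (\<lambda>b::'v. lborel :: real measure)"
    by (rule sigma_finite) simp
  interpret Y: pair_sigma_finite "PiM B (\<lambda>b::'v. lborel :: real measure)" "lborel :: 'v measure" ..
  let ?P = "PiM B (\<lambda>b::'v. lborel :: real measure)"
  let ?f = "\<lambda>c y. ennreal (exp (- (norm y)\<^sup>2 - t * (norm (y - (\<Sum>b\<in>B. c b *\<^sub>R b)))\<^sup>2))"
  have gauss: "(\<integral>\<^sup>+c. ennreal (exp (- u * (\<Sum>b\<in>B. (c b - a b)\<^sup>2))) \<partial>?P) = ennreal ((pi / u) powr (card B / 2))"
    if "0 < u" for u and a :: "'v \<Rightarrow> real"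
  proof -
    have "(\<integral>\<^sup>+c. ennreal (exp (- u * (\<Sum>b\<in>B. (c b - a b)\<^sup>2))) \<partial>?P) =
        (\<integral>\<^sup>+c. (\<Prod>b\<in>B. ennreal (exp (- u * (c b - a b)\<^sup>2))) \<partial>?P)"
      by (simp add: prod_ennreal exp_sum sum_distrib_left sum_negf[symmetric])
    also have "\<dots> = (\<Prod>b\<in>B. \<integral>\<^sup>+x. ennreal (exp (- u * (x - a b)\<^sup>2)) \<partial>lborel)"
      by (rule product_nn_integral_prod) auto
    also have "\<dots> = ennreal ((pi / u) powr (card B / 2))"
      unfolding nn_integral_exp_square[OF that]
      using that sqrt_power_eq_powr[of "pi / u"] by (simp add: ennreal_power)
    finally show ?thesis .
  qed
  \<comment> \<open>Integrating over the span first produces the exponential of the residual.\<close>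
  have inner_c: "(\<integral>\<^sup>+c. ?f c y \<partial>?P) =
      ennreal ((pi / t) powr (card B / 2)) * ennreal (exp (- (norm y)\<^sup>2 - t * residual_square B y))" for y
  proof -
    have "?f c y = ennreal (exp (- (norm y)\<^sup>2 - t * residual_square B y)) *
        ennreal (exp (- t * (\<Sum>b\<in>B. (c b - y \<bullet> b)\<^sup>2)))" for c
      unfolding norm_diff_orthonormal_sum[OF B]
        ennreal_mult'[OF exp_ge_zero, symmetric] mult_exp_exp
      by (intro arg_cong[where f=ennreal] arg_cong[where f=exp]) (simp add: algebra_simps)
    then show ?thesis
      using gauss[OF t] by (simp add: nn_integral_cmult mult.commute)
  qed
  \<comment> \<open>Integrating over \<open>y\<close> first: the exponent is a shifted multiple of the squared norm.\<close>
  have inner_y: "(\<integral>\<^sup>+y. ?f c y \<partial>lborel) =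
      ennreal ((pi / (1 + t)) powr (DIM('v) / 2)) * ennreal (exp (- (t / (1 + t)) * (\<Sum>b\<in>B. (c b - 0)\<^sup>2)))" for c
  proof -
    define w where "w = (\<Sum>b\<in>B. c b *\<^sub>R b)"
    have "(norm y)\<^sup>2 + t * (norm (y - w))\<^sup>2 =
        (1 + t) * (norm (y - (t / (1 + t)) *\<^sub>R w))\<^sup>2 + t / (1 + t) * (norm w)\<^sup>2" for y
    proof -
      have norms: "(norm (y - a *\<^sub>R w))\<^sup>2 = (norm y)\<^sup>2 - 2 * a * (y \<bullet> w) + a\<^sup>2 * (norm w)\<^sup>2" for a
        unfolding power2_norm_eq_inner
        by (simp add: inner_diff_left inner_diff_right inner_commute power2_eq_square algebra_simps)
      define a where "a = t / (1 + t)"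
      have "(1 + t) * a = t" using t by (simp add: a_def)
      moreover from this have "(1 + t) * a\<^sup>2 + a = t"
        by (simp add: power2_eq_square mult.assoc[symmetric]) (simp add: algebra_simps)
      moreover have "(1 + t) * (P - 2 * a * J + a\<^sup>2 * W) + a * W =
          (1 + t) * P - 2 * ((1 + t) * a) * J + ((1 + t) * a\<^sup>2 + a) * W" for P J W :: real
        by (simp add: algebra_simps)
      ultimately have "P + t * (P - 2 * 1 * J + 1\<^sup>2 * W) =
          (1 + t) * (P - 2 * a * J + a\<^sup>2 * W) + a * W" for P J W :: real
        by (simp add: algebra_simps)
      then show ?thesis
        unfolding a_def[symmetric] norms norms[of 1, unfolded scaleR_one] .
    qed
    then have "?f c y = ennreal (exp (- (t / (1 + t)) * (\<Sum>b\<in>B. (c b - 0)\<^sup>2))) *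
        ennreal (exp (- (1 + t) * (norm (y - (t / (1 + t)) *\<^sub>R w))\<^sup>2))" for y
      unfolding w_def[symmetric] diff_0_right orthonormal_norm_sum[OF B, symmetric]
        ennreal_mult'[OF exp_ge_zero, symmetric] mult_exp_exp
      by (intro arg_cong[where f=ennreal] arg_cong[where f=exp]) (simp add: algebra_simps)
    then show ?thesis
      using nn_integral_exp_norm_square[of "1 + t" "(t / (1 + t)) *\<^sub>R w"] t
      by (simp add: nn_integral_cmult mult.commute)
  qed
  have "ennreal ((pi / t) powr (card B / 2)) * (\<integral>\<^sup>+y. ennreal (exp (- (norm y)\<^sup>2 - t * residual_square B y)) \<partial>lborel)
      = (\<integral>\<^sup>+y. \<integral>\<^sup>+c. ?f c y \<partial>?P \<partial>lborel)"
    unfolding inner_c by (rule nn_integral_cmult[symmetric]) (simp add: residual_square_def)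
  also have "\<dots> = (\<integral>\<^sup>+c. \<integral>\<^sup>+y. ?f c y \<partial>lborel \<partial>?P)"
    by (rule Y.Fubini') measurable
  also have "\<dots> = ennreal ((pi / (1 + t)) powr (DIM('v) / 2) * (pi / (t / (1 + t))) powr (card B / 2))"
    unfolding inner_y using gauss[of "t / (1 + t)" "\<lambda>_. 0"] t
    by (subst nn_integral_cmult) (auto simp: ennreal_mult')
  finally have "ennreal ((t / pi) powr (card B / 2)) * (ennreal ((pi / t) powr (card B / 2)) *
      (\<integral>\<^sup>+y. ennreal (exp (- (norm y)\<^sup>2 - t * residual_square B y)) \<partial>lborel)) =
      ennreal ((t / pi) powr (card B / 2)) * ennreal ((pi / (1 + t)) powr (DIM('v) / 2) * (pi / (t / (1 + t))) powr (card B / 2))"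
    by simp
  moreover have "(t / pi) powr (card B / 2) * (pi / t) powr (card B / 2) = 1"
    using t by (simp flip: powr_mult)
  moreover have "(t / pi) powr (card B / 2) * ((pi / (1 + t)) powr (DIM('v) / 2) * (pi / (t / (1 + t))) powr (card B / 2))
      = pi powr (DIM('v) / 2) * (1 + t) powr (- ((real (DIM('v)) - real (card B)) / 2))"
  proof -
    have "t / pi * (pi / (t / (1 + t))) = 1 + t"
      using t by simp
    then have "(t / pi) powr (card B / 2) * (pi / (t / (1 + t))) powr (card B / 2) = (1 + t) powr (card B / 2)"
      using t by (metis powr_mult)
    moreover have "(1 + t) powr (- ((real (DIM('v)) - real (card B)) / 2)) =
        (1 + t) powr (card B / 2) / (1 + t) powr (DIM('v) / 2)"
      by (simp add: diff_divide_distrib flip: powr_diff)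
    moreover have "(pi / (1 + t)) powr (DIM('v) / 2) = pi powr (DIM('v) / 2) / (1 + t) powr (DIM('v) / 2)"
      using t by (simp add: powr_divide)
    ultimately show ?thesis by (simp only: mult.left_commute[of "(t / pi) powr _"]) simp
  qed
  ultimately show ?thesis
    by (simp flip: mult.assoc ennreal_mult')
qed

text \<open>A form of the Beta integral. It follows from Tonelli's theorem when \<open>(1 + t) powr - b\<close> is replaced by its
representation as a Gamma integral.\<close>
lemma nn_integral_Gamma_ratio:
  fixes s b :: real
  assumes "0 < s" "s < b"
  shows "(\<integral>\<^sup>+t. indicator {0<..} t * ennreal (t powr (s - 1) * (1 + t) powr - b) \<partial>lborel)
    = ennreal (Gamma s * Gamma (b - s) / Gamma b)"
proof -
  have b: "0 < b" using assms by simp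
  let ?J = "\<integral>\<^sup>+t. indicator {0<..} t * ennreal (t powr (s - 1) * (1 + t) powr - b) \<partial>lborel"
  let ?f = "\<lambda>t u. indicator {0<..} t * indicator {0<..} u *
      ennreal (t powr (s - 1) * u powr (b - 1) * exp (- u - u * t))"
  have ind: "AE x in lborel. (x::real) \<noteq> 0" by (rule AE_lborel_singleton)
  have "ennreal (Gamma b) * ?J = (\<integral>\<^sup>+t. \<integral>\<^sup>+u. ?f t u \<partial>lborel \<partial>lborel)"
  proof (subst nn_integral_cmult[symmetric], simp, rule nn_integral_cong)
    fix t :: real
    show "ennreal (Gamma b) * (indicator {0<..} t * ennreal (t powr (s - 1) * (1 + t) powr - b)) =
        (\<integral>\<^sup>+u. ?f t u \<partial>lborel)"
    proof (cases "t > 0")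
      case True
      have split: "- u - u * t = - (1 + t) * u" for u :: real
        by (simp add: algebra_simps)
      have "(\<integral>\<^sup>+u. ?f t u \<partial>lborel) =
          (\<integral>\<^sup>+u. ennreal (t powr (s - 1)) * (indicator {0..} u * ennreal (u powr (b - 1) * exp (- (1 + t) * u))) \<partial>lborel)"
        using True ind split by (intro nn_integral_cong_AE)
          (auto elim!: eventually_mono simp: indicator_def simp flip: ennreal_mult')
      also have "\<dots> = ennreal (t powr (s - 1)) * ennreal (Gamma b * (1 + t) powr - b)"
        using True nn_integral_Gamma_scaled[OF b, of "1 + t"] by (subst nn_integral_cmult) auto
      finally show ?thesis using True b by (simp add: ac_simps flip: ennreal_mult')
    qed simp
  qed
  also have "\<dots> = (\<integral>\<^sup>+u. \<integral>\<^sup>+t. ?f t u \<partial>lborel \<partial>lborel)"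
    by (rule lborel_pair.Fubini'[symmetric]) measurable
  also have "\<dots> = (\<integral>\<^sup>+u. ennreal (Gamma s) * (indicator {0..} u * ennreal (u powr (b - s - 1) * exp (- 1 * u))) \<partial>lborel)"
  proof (rule nn_integral_cong_AE, use ind in eventually_elim)
    fix u :: real assume "u \<noteq> 0"
    show "(\<integral>\<^sup>+t. ?f t u \<partial>lborel) = ennreal (Gamma s) * (indicator {0..} u * ennreal (u powr (b - s - 1) * exp (- 1 * u)))"
    proof (cases "u > 0")
      case True
      have split: "exp (- u - u * t) = exp (- u) * exp (- u * t)" for t
        by (simp add: mult_exp_exp)
      have "(\<integral>\<^sup>+t. ?f t u \<partial>lborel) =
          (\<integral>\<^sup>+t. ennreal (u powr (b - 1) * exp (- u)) * (indicator {0..} t * ennreal (t powr (s - 1) * exp (- u * t))) \<partial>lborel)"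
        using True ind split by (intro nn_integral_cong_AE)
          (auto elim!: eventually_mono simp: indicator_def mult_ac simp flip: ennreal_mult')
      also have "\<dots> = ennreal (u powr (b - 1) * exp (- u)) * ennreal (Gamma s * u powr - s)"
        using True nn_integral_Gamma_scaled[OF \<open>0 < s\<close> True] by (subst nn_integral_cmult) auto
      also have "\<dots> = ennreal (Gamma s * (u powr (b - 1) * u powr - s * exp (- u)))"
        by (subst ennreal_mult'[symmetric]) (simp_all add: ac_simps)
      also have "u powr (b - 1) * u powr - s = u powr (b - s - 1)"
        by (simp add: algebra_simps flip: powr_add)
      finally show ?thesis using True assms by (simp add: ac_simps flip: ennreal_mult')
    qed (use \<open>u \<noteq> 0\<close> in simp)
  qed
  also have "\<dots> = ennreal (Gamma s) * ennreal (Gamma (b - s))"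
    using nn_integral_Gamma_scaled[of "b - s" 1] assms by (subst nn_integral_cmult) auto
  finally have "ennreal (1 / Gamma b) * (ennreal (Gamma b) * ?J) = ennreal (1 / Gamma b) * (ennreal (Gamma s) * ennreal (Gamma (b - s)))"
    by simp
  moreover have "Gamma b > 0" "Gamma s > 0" "Gamma (b - s) > 0" using assms by auto
  ultimately show ?thesis by (simp flip: mult.assoc ennreal_mult')
qed

text \<open>In probabilistic terms: if \<open>y\<close> has a density proportional to \<open>exp (- (norm y)\<^sup>2)\<close>, its squared distance to a
subspace of codimension \<open>d\<close> has a Gamma distribution with parameter \<open>d / 2\<close>, and up to the
normalization of the density this is its moment of order \<open>- s\<close>.
The power is expanded into exponentials, which reduces the claim to the previous two lemmas.\<close>
theorem nn_integral_residual_powr: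
  fixes B :: "'v::euclidean_space set" and s :: real
  assumes B: "orthonormal B" and s: "0 < s" "s < (real (DIM('v)) - real (card B)) / 2"
  shows "(\<integral>\<^sup>+y. ennreal (exp (- (norm y)\<^sup>2) * residual_square B y powr - s) \<partial>lborel)
    = ennreal (pi powr (DIM('v) / 2) * Gamma ((real (DIM('v)) - real (card B)) / 2 - s)
        / Gamma ((real (DIM('v)) - real (card B)) / 2))"
proof -
  define b where "b = (real (DIM('v)) - real (card B)) / 2"
  have b: "s < b" "0 < b" using s by (auto simp: b_def)
  have meas[measurable]: "residual_square B \<in> borel_measurable borel"
    unfolding residual_square_def[abs_def] by measurable
  let ?f = "\<lambda>t y. indicator {0<..} t * ennreal (t powr (s - 1) * exp (- (norm y)\<^sup>2 - t * residual_square B y))"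
  let ?J = "\<integral>\<^sup>+y. ennreal (exp (- (norm y)\<^sup>2) * residual_square B y powr - s) \<partial>lborel"
  \<comment> \<open>On the span the expansion into exponentials diverges while \<open>0 powr - s\<close> is 0.\<close>
  have "negligible (span B)"
    using b orthonormal_finite[OF B] dim_le_card'[of B]
    by (intro negligible_lowdim) (simp add: b_def)
  then have AE: "AE y in lborel. y \<notin> span B"
    by (metis AE_not_in completion.AE_iff_null_sets negligible_iff_null_sets AE_completion_iff) 
  have "ennreal (Gamma s) * ?J = (\<integral>\<^sup>+y. \<integral>\<^sup>+t. ?f t y \<partial>lborel \<partial>lborel)"
  proof (subst nn_integral_cmult[symmetric], simp, rule nn_integral_cong_AE, use AE in eventually_elim)
    fix y :: 'v assume "y \<notin> span B"
    then have Q: "0 < residual_square B y"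
      using residual_square_eq_0[OF B, of y] residual_square_nonneg[OF B, of y] by force
    have split: "exp (- (norm y)\<^sup>2 - t * residual_square B y) =
        exp (- (norm y)\<^sup>2) * exp (- residual_square B y * t)" for t
      by (simp add: mult_exp_exp mult.commute)
    have "(\<integral>\<^sup>+t. ?f t y \<partial>lborel) = (\<integral>\<^sup>+t. ennreal (exp (- (norm y)\<^sup>2)) *
        (indicator {0..} t * ennreal (t powr (s - 1) * exp (- residual_square B y * t))) \<partial>lborel)"
      using AE_lborel_singleton[of "0::real"] by (intro nn_integral_cong_AE)
        (auto elim!: eventually_mono simp: split indicator_def mult_ac simp flip: ennreal_mult')
    also have "\<dots> = ennreal (exp (- (norm y)\<^sup>2)) * ennreal (Gamma s * residual_square B y powr - s)"
      using nn_integral_Gamma_scaled[OF s(1) Q] by (subst nn_integral_cmult) auto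
    finally show "ennreal (Gamma s) * ennreal (exp (- (norm y)\<^sup>2) * residual_square B y powr - s) = (\<integral>\<^sup>+t. ?f t y \<partial>lborel)"
      using s by (simp add: ac_simps flip: ennreal_mult')
  qed
  also have "\<dots> = (\<integral>\<^sup>+t. \<integral>\<^sup>+y. ?f t y \<partial>lborel \<partial>lborel)"
    by (rule lborel_pair.Fubini') measurable
  also have "\<dots> = (\<integral>\<^sup>+t. ennreal (pi powr (DIM('v) / 2)) * (indicator {0<..} t * ennreal (t powr (s - 1) * (1 + t) powr - b)) \<partial>lborel)"
  proof (rule nn_integral_cong)
    fix t :: real
    show "(\<integral>\<^sup>+y. ?f t y \<partial>lborel) = ennreal (pi powr (DIM('v) / 2)) * (indicator {0<..} t * ennreal (t powr (s - 1) * (1 + t) powr - b))"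
    proof (cases "t > 0")
      case True
      have "(\<integral>\<^sup>+y. ?f t y \<partial>lborel) = ennreal (t powr (s - 1)) *
          (\<integral>\<^sup>+y. ennreal (exp (- (norm y)\<^sup>2 - t * residual_square B y)) \<partial>lborel)"
        using True by (simp add: ennreal_mult' nn_integral_cmult)
      also have "\<dots> = ennreal (t powr (s - 1)) * ennreal (pi powr (DIM('v) / 2) * (1 + t) powr - b)"
        unfolding nn_integral_exp_residual[OF B True] by (simp add: b_def)
      finally show ?thesis using True by (simp add: ac_simps flip: ennreal_mult')
    qed simp
  qed
  also have "\<dots> = ennreal (pi powr (DIM('v) / 2)) * ennreal (Gamma s * Gamma (b - s) / Gamma b)"
    using nn_integral_Gamma_ratio[OF s(1) b(1)] by (subst nn_integral_cmult) auto
  finally have "ennreal (1 / Gamma s) * (ennreal (Gamma s) * ?J) =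
      ennreal (1 / Gamma s) * (ennreal (pi powr (DIM('v) / 2)) * ennreal (Gamma s * Gamma (b - s) / Gamma b))"
    by simp
  moreover have "Gamma s > 0" "Gamma b > 0" using s b by auto
  ultimately show ?thesis
    by (simp add: b_def flip: mult.assoc ennreal_mult')
qed

section \<open>Gram determinants of complex vectors\<close>

definition cinner :: "complex^'m \<Rightarrow> complex^'m \<Rightarrow> complex"
  where "cinner x y = (\<Sum>k\<in>UNIV. x $ k * cnj (y $ k))"

text \<open>Outside \<open>I\<close> the matrix is completed by the identity. So the Gram determinants of all subfamilies are
determinants over one index type, and an induction over \<open>I\<close> can add the vectors one at a time.\<close>
definition gram :: "'n set \<Rightarrow> ('n \<Rightarrow> complex^'m) \<Rightarrow> complex^'n^'n"
  where "gram I \<phi> = (\<chi> i j. if i \<in> I \<and> j \<in> I then cinner (\<phi> i) (\<phi> j) else if i = j then 1 else 0)"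

definition cspan :: "'n set \<Rightarrow> ('n \<Rightarrow> complex^'m) \<Rightarrow> (complex^'m) set"
  where "cspan I \<phi> = range (\<lambda>c. \<Sum>i\<in>I. c i *s \<phi> i)"

lemma Re_cinner: "Re (cinner x y) = x \<bullet> y"
  by (simp add: cinner_def inner_vec_def inner_complex_def)

lemma cinner_self: "cinner x x = complex_of_real ((norm x)\<^sup>2)"
  by (simp add: cinner_def norm_vec_def L2_set_def sum_nonneg complex_norm_square[symmetric])

lemma cinner_scale_left: "cinner (c *s x) y = c * cinner x y"
  by (simp add: cinner_def sum_distrib_left mult.assoc)

lemma cinner_add_left: "cinner (x + y) z = cinner x z + cinner y z"
  by (simp add: cinner_def distrib_right sum.distrib)

lemma cinner_sum_left: "cinner (\<Sum>i\<in>I. f i) z = (\<Sum>i\<in>I. cinner (f i) z)"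
  by (induction I rule: infinite_finite_induct)
     (auto simp: cinner_add_left, auto simp: cinner_def)

lemma cinner_commute: "cinner x y = cnj (cinner y x)"
  by (simp add: cinner_def mult.commute)

lemma scaleR_conv_vector_scale: "r *\<^sub>R x = complex_of_real r *s x"
  by (simp add: vec_eq_iff) (simp add: scaleR_conv_of_real)

lemma cspan_scale: "v \<in> cspan I \<phi> \<Longrightarrow> c *s v \<in> cspan I \<phi>"
proof -
  assume "v \<in> cspan I \<phi>"
  then obtain d where "v = (\<Sum>i\<in>I. d i *s \<phi> i)" unfolding cspan_def by auto
  then have "c *s v = (\<Sum>i\<in>I. (c * d i) *s \<phi> i)"
    by (simp add: vec.scale_sum_right)
  then show ?thesis unfolding cspan_def by (rule range_eqI[where x="\<lambda>i. c * d i"])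
qed

lemma subspace_cspan: "subspace (cspan I \<phi>)"
proof (rule subspaceI)
  show "0 \<in> cspan I \<phi>"
    unfolding cspan_def by (rule range_eqI[of _ _ "\<lambda>_. 0"]) simp
  show "c *\<^sub>R x \<in> cspan I \<phi>" if "x \<in> cspan I \<phi>" for c x
    using cspan_scale[OF that] by (simp add: scaleR_conv_vector_scale)
  fix x y assume "x \<in> cspan I \<phi>" "y \<in> cspan I \<phi>"
  then obtain c d where "x = (\<Sum>i\<in>I. c i *s \<phi> i)" "y = (\<Sum>i\<in>I. d i *s \<phi> i)"
    unfolding cspan_def by auto
  then show "x + y \<in> cspan I \<phi>"
    unfolding cspan_def
    by (intro range_eqI[of _ _ "\<lambda>i. c i + d i"]) (simp add: vec.scale_left_distrib sum.distrib)
qed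

lemma cspan_base: "finite I \<Longrightarrow> i \<in> I \<Longrightarrow> \<phi> i \<in> cspan I \<phi>"
  unfolding cspan_def
  by (rule range_eqI[of _ _ "\<lambda>j. if j = i then 1 else 0"]) (simp add: if_distrib[of "\<lambda>c. c *s _"] cong: if_cong)

text \<open>Real orthogonality only controls the real part of the Hermitian product. The imaginary part is the
real inner product with a rotated vector, which stays in the complex span.\<close>
lemma cinner_eq_0_if_orthogonal_cspan:
  assumes "\<And>w. w \<in> cspan I \<phi> \<Longrightarrow> r \<bullet> w = 0" and "v \<in> cspan I \<phi>"
  shows "cinner r v = 0"
proof -
  have "cinner r (\<i> *s v) = - \<i> * cinner r v"
    by (subst (1 2) cinner_commute) (simp add: cinner_scale_left)
  then have "Im (cinner r v) = r \<bullet> (\<i> *s v)"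
    by (simp add: Re_cinner[symmetric])
  then show ?thesis
    using assms cspan_scale[OF assms(2), of \<i>] by (simp add: complex_eq_iff Re_cinner)
qed

text \<open>The complex span is treated as a real subspace, since distances and Gaussian integrals refer to the
real inner product; one complex direction contributes two real ones.\<close>
lemma cspan_insert:
  assumes "finite I" "a \<notin> I"
  shows "cspan (insert a I) \<phi> = span (insert (\<i> *s \<phi> a) (insert (\<phi> a) (cspan I \<phi>)))"
proof (rule equalityI)
  show "cspan (insert a I) \<phi> \<subseteq> span (insert (\<i> *s \<phi> a) (insert (\<phi> a) (cspan I \<phi>)))"
  proof
    fix x assume "x \<in> cspan (insert a I) \<phi>"
    then obtain c where "x = c a *s \<phi> a + (\<Sum>i\<in>I. c i *s \<phi> i)"
      using assms unfolding cspan_def by auto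
    also have "c a *s \<phi> a = Re (c a) *\<^sub>R \<phi> a + Im (c a) *\<^sub>R (\<i> *s \<phi> a)"
      by (subst complex_eq[of "c a"]) (simp add: scaleR_conv_vector_scale vec.scale_left_distrib mult.commute)
    finally show "x \<in> span (insert (\<i> *s \<phi> a) (insert (\<phi> a) (cspan I \<phi>)))"
      by (simp only:) (intro span_add span_scale span_base, auto simp: cspan_def)
  qed
  have "cspan I \<phi> \<subseteq> cspan (insert a I) \<phi>"
  proof
    fix x assume "x \<in> cspan I \<phi>"
    then obtain c where "x = (\<Sum>i\<in>I. c i *s \<phi> i)" unfolding cspan_def by auto
    then have "x = (\<Sum>i\<in>insert a I. (c(a := 0)) i *s \<phi> i)"
      using assms by (auto intro!: sum.cong)
    then show "x \<in> cspan (insert a I) \<phi>"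
      unfolding cspan_def by (rule range_eqI[where x="c(a := 0)"])
  qed
  moreover have "\<phi> a \<in> cspan (insert a I) \<phi>" using assms by (intro cspan_base) auto
  ultimately show "span (insert (\<i> *s \<phi> a) (insert (\<phi> a) (cspan I \<phi>))) \<subseteq> cspan (insert a I) \<phi>"
    using cspan_scale[of "\<phi> a" "insert a I" \<phi> \<i>] by (intro span_minimal subspace_cspan) simp
qed

lemma dim_cspan_insert:
  assumes "finite I" "a \<notin> I" "\<phi> a \<notin> cspan I \<phi>"
  shows "dim (cspan (insert a I) \<phi>) = dim (cspan I \<phi>) + 2"
proof -
  let ?V = "cspan I \<phi>" and ?y = "\<phi> a"
  have V: "span ?V = ?V" by (simp add: span_eq_iff subspace_cspan)
  have "\<i> *s ?y \<notin> span (insert ?y ?V)"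
  proof
    assume "\<i> *s ?y \<in> span (insert ?y ?V)"
    then obtain r where "\<i> *s ?y - r *\<^sub>R ?y \<in> ?V"
      by (auto simp: span_insert V)
    then have "(\<i> - complex_of_real r) *s ?y \<in> ?V"
      by (simp add: scaleR_conv_vector_scale vec.scale_left_diff_distrib)
    from cspan_scale[OF this, of "inverse (\<i> - complex_of_real r)"]
    have "(inverse (\<i> - complex_of_real r) * (\<i> - complex_of_real r)) *s ?y \<in> ?V"
      by (simp only: vec.scale_scale)
    moreover have "\<i> - complex_of_real r \<noteq> 0" by (simp add: complex_eq_iff)
    ultimately have "?y \<in> ?V" by simp
    with assms show False by simp
  qed
  then show ?thesis
    using assms by (simp add: cspan_insert dim_insert V)
qed

text \<open>Every permutation that contributes to the determinant fixes \<open>a\<close>, hence the rest of the column is never seen.\<close>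
lemma det_axis_row_cong:
  fixes A A' :: "'a::comm_ring_1^'n^'n"
  assumes "\<And>j. j \<noteq> a \<Longrightarrow> A $ a $ j = 0" "\<And>j. j \<noteq> a \<Longrightarrow> A' $ a $ j = 0"
    and "A $ a $ a = A' $ a $ a"
    and "\<And>i j. i \<noteq> a \<Longrightarrow> j \<noteq> a \<Longrightarrow> A $ i $ j = A' $ i $ j"
  shows "det A = det A'"
  unfolding det_def
proof (rule sum.cong[OF refl])
  fix p :: "'n \<Rightarrow> 'n" assume "p \<in> {p. p permutes UNIV}"
  then have inj: "p i = p j \<Longrightarrow> i = j" for i j by (auto dest: permutes_inj injD)
  have "(\<Prod>i\<in>UNIV. A $ i $ p i) = (\<Prod>i\<in>UNIV. A' $ i $ p i)"
  proof (cases "p a = a")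
    case True
    then show ?thesis
      using assms inj by (intro prod.cong refl) (metis)
  next
    case False
    then have "A $ a $ p a = 0" "A' $ a $ p a = 0" using assms by auto
    then show ?thesis
      by (metis (mono_tags, lifting) UNIV_I finite_class.finite_UNIV prod_zero)
  qed
  then show "of_int (sign p) * (\<Prod>i\<in>UNIV. A $ i $ p i) = of_int (sign p) * (\<Prod>i\<in>UNIV. A' $ i $ p i)"
    by simp
qed

text \<open>Base times height: subtracting from the new vector its projection \<open>v\<close> onto the span of the others is
a row operation on the Gram matrix, and the remainder \<open>r\<close> is orthogonal to all other vectors. The row of
\<open>a\<close> becomes the squared length of \<open>r\<close> times a unit vector.\<close>
lemma det_gram_insert:
  fixes \<phi> :: "'n::finite \<Rightarrow> complex^'m"
  assumes a: "a \<notin> I" and B: "orthonormal B" "span B = cspan I \<phi>"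
  shows "det (gram (insert a I) \<phi>) = complex_of_real (residual_square B (\<phi> a)) * det (gram I \<phi>)"
proof -
  define v where "v = (\<Sum>b\<in>B. (\<phi> a \<bullet> b) *\<^sub>R b)"
  define r where "r = \<phi> a - v"
  have v: "v \<in> cspan I \<phi>"
    unfolding v_def B(2)[symmetric] by (intro span_sum span_scale span_base)
  have "r \<bullet> b = 0" if "b \<in> B" for b
    using that by (simp add: r_def v_def inner_diff_left orthonormal_inner_sum[OF B(1)])
  then have "r \<bullet> w = 0" if "w \<in> cspan I \<phi>" for w
    using that unfolding B(2)[symmetric] using orthogonal_to_span[of w B r]
    by (simp add: orthogonal_def)
  then have r_orth: "cinner r w = 0" "cinner w r = 0" if "w \<in> cspan I \<phi>" for w
    using cinner_eq_0_if_orthogonal_cspan that cinner_commute[of w r] by (metis, metis complex_cnj_zero)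
  have nr: "(norm r)\<^sup>2 = residual_square B (\<phi> a)"
    using norm_diff_orthonormal_sum[OF B(1), of "\<phi> a" "\<lambda>b. \<phi> a \<bullet> b"] by (simp add: r_def v_def)
  obtain p where p: "v = (\<Sum>i\<in>I. p i *s \<phi> i)" using v unfolding cspan_def by auto
  have phi_a: "\<phi> a = r + (\<Sum>i\<in>I. p i *s \<phi> i)" by (simp add: r_def p)
  have r_a: "cinner r (\<phi> a) = complex_of_real ((norm r)\<^sup>2)"
  proof -
    have "cinner r (\<phi> a) = cnj (cinner r r) + cnj (cinner v r)"
      by (subst cinner_commute) (simp add: r_def flip: cinner_add_left complex_cnj_add)
    then show ?thesis using r_orth v by (simp add: cinner_self)
  qed
  let ?e = "axis a 1 :: complex^'n"
  define A0 where "A0 = (\<chi> k. if k = a then complex_of_real ((norm r)\<^sup>2) *s ?e else row k (gram (insert a I) \<phi>))"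
  define x where "x = (\<Sum>i\<in>I. p i *s row i A0)"
  have x: "x \<in> vec.span {row j A0 |j. j \<noteq> a}"
    unfolding x_def using a by (intro vec.span_sum vec.span_scale vec.span_base) auto
  have "gram (insert a I) \<phi> = (\<chi> k. if k = a then row a A0 + x else row k A0)"
  proof -
    have "gram (insert a I) \<phi> $ a $ j = (row a A0 + x) $ j" for j
    proof -
      have "x $ j = (\<Sum>i\<in>I. p i * gram (insert a I) \<phi> $ i $ j)"
        unfolding x_def A0_def using a
        by (auto simp: row_def intro!: sum.cong)
      moreover have "row a A0 $ j = (if j = a then complex_of_real ((norm r)\<^sup>2) else 0)"
        by (simp add: A0_def row_def axis_def)
      moreover have "gram (insert a I) \<phi> $ a $ j = (if j = a then complex_of_real ((norm r)\<^sup>2) else 0) +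
          (\<Sum>i\<in>I. p i * gram (insert a I) \<phi> $ i $ j)"
      proof (cases "j \<in> insert a I")
        case True
        have "cinner r (\<phi> j) = (if j = a then complex_of_real ((norm r)\<^sup>2) else 0)"
          using True a r_a r_orth cspan_base[of I j \<phi>] by auto
        moreover have "cinner (\<phi> a) (\<phi> j) = cinner r (\<phi> j) + (\<Sum>i\<in>I. p i * cinner (\<phi> i) (\<phi> j))"
          by (subst phi_a) (simp add: cinner_add_left cinner_sum_left cinner_scale_left)
        ultimately show ?thesis using True by (auto simp: gram_def intro!: sum.cong)
      next
        case False
        then have "(\<Sum>i\<in>I. p i * gram (insert a I) \<phi> $ i $ j) = 0"
          by (intro sum.neutral) (auto simp: gram_def)
        then show ?thesis using False by (auto simp: gram_def)
      qed
      ultimately show ?thesis by simp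
    qed
    moreover have "row k A0 = gram (insert a I) \<phi> $ k" if "k \<noteq> a" for k
      using that by (simp add: A0_def row_def vec_eq_iff)
    ultimately show ?thesis by (simp add: vec_eq_iff)
  qed
  then have "det (gram (insert a I) \<phi>) = det A0"
    using det_row_span[OF x] by simp
  also have "\<dots> = complex_of_real ((norm r)\<^sup>2) * det (\<chi> k. if k = a then ?e else row k (gram (insert a I) \<phi>))"
    unfolding A0_def by (rule det_row_mul)
  also have "det (\<chi> k. if k = a then ?e else row k (gram (insert a I) \<phi>)) = det (gram I \<phi>)"
    using a by (intro det_axis_row_cong[of a]) (auto simp: axis_def gram_def row_def)
  finally show ?thesis by (simp add: nr)
qed

lemma orthonormal_basis_cspan:
  fixes \<phi> :: "'n \<Rightarrow> complex^'m"
  obtains B where "orthonormal B" "span B = cspan I \<phi>" "card B = dim (cspan I \<phi>)"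
  using orthonormal_basis_subspace[OF subspace_cspan[of I \<phi>]] unfolding orthonormal_def by metis

lemma det_gram_real_nonneg:
  fixes \<phi> :: "'n::finite \<Rightarrow> complex^'m"
  shows "\<exists>d\<ge>0. det (gram I \<phi>) = complex_of_real d"
proof (induction I rule: finite_induct[OF finite])
  case 1
  have "gram {} \<phi> = mat 1" by (simp add: gram_def mat_def vec_eq_iff)
  then show ?case by (intro exI[of _ 1]) (simp add: det_I)
next
  case (2 a I)
  obtain B where B: "orthonormal B" "span B = cspan I \<phi>" using orthonormal_basis_cspan by metis
  from 2 obtain d where "d \<ge> 0" "det (gram I \<phi>) = complex_of_real d" by auto
  then show ?case
    using det_gram_insert[OF 2(2) B] residual_square_nonneg[OF B(1), of "\<phi> a"]
    by (intro exI[of _ "residual_square B (\<phi> a) * d"]) auto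
qed

text \<open>A nonzero Gram determinant means that each new vector has a nonzero distance to the span of the
previous ones, so that the real dimension increases by two in every step.\<close>
lemma dim_cspan_if_det_gram:
  fixes \<phi> :: "'n::finite \<Rightarrow> complex^'m"
  assumes "det (gram I \<phi>) \<noteq> 0"
  shows "dim (cspan I \<phi>) = 2 * card I"
  using finite[of I] assms
proof (induction I rule: finite_induct)
  case empty
  then show ?case by (simp add: cspan_def)
next
  case (insert a I)
  obtain B where B: "orthonormal B" "span B = cspan I \<phi>" using orthonormal_basis_cspan by metis
  note det = det_gram_insert[OF insert(2) B] 
  have "\<phi> a \<notin> cspan I \<phi>"
  proof
    assume mem: "\<phi> a \<in> cspan I \<phi>"
    define r where "r = \<phi> a - (\<Sum>b\<in>B. (\<phi> a \<bullet> b) *\<^sub>R b)"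
    have "r \<in> span B"
      unfolding r_def using mem B(2) by (intro span_diff span_sum span_scale) (auto intro: span_base)
    moreover have "r \<bullet> b = 0" if "b \<in> B" for b
      using that by (simp add: r_def inner_diff_left orthonormal_inner_sum[OF B(1)])
    ultimately have "r \<bullet> r = 0"
      using orthogonal_to_span[of r B r] by (simp add: orthogonal_def)
    then have "residual_square B (\<phi> a) = 0"
      using norm_diff_orthonormal_sum[OF B(1), of "\<phi> a" "\<lambda>b. \<phi> a \<bullet> b"] by (simp add: r_def[symmetric])
    with det insert.prems show False by simp
  qed
  then show ?case
    using insert det by (simp add: dim_cspan_insert)
qed

lemma measurable_vec_nth[measurable]: "(\<lambda>x. x $ i) \<in> borel_measurable borel"
  for i :: "'i::finite" and x :: "'b::euclidean_space ^ 'i"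
  by (intro borel_measurable_continuous_onI continuous_intros)

lemma measurable_det_gram[measurable]:
  fixes I :: "'n::finite set"
  shows "(\<lambda>\<phi>. Re (det (gram I \<phi>))) \<in> borel_measurable (PiM I (\<lambda>_. lborel :: (complex^'m) measure))"
proof -
  have [measurable]: "cnj \<in> borel_measurable borel"
    by (intro borel_measurable_continuous_onI continuous_intros)
  have "(\<lambda>\<phi>. gram I \<phi> $ i $ j) \<in> borel_measurable (PiM I (\<lambda>_. lborel :: (complex^'m) measure))" for i j
    unfolding gram_def cinner_def by (cases "i \<in> I \<and> j \<in> I") (auto, measurable)
  then have [measurable]: "(\<lambda>\<phi>. det (gram I \<phi>)) \<in> borel_measurable (PiM I (\<lambda>_. lborel :: (complex^'m) measure))"
    unfolding det_def by measurable
  show ?thesis by measurable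
qed

text \<open>The random Gram determinant of independent Gaussian vectors is a product of squared distances. With the
vectors in \<open>I\<close> held fixed, integration over the next one yields a constant that depends only on
their number, by the formula for the distance to a subspace; thus the integral is a product of Gamma ratios.
Linearly dependent families make no trouble because \<open>0 powr - s\<close> is 0, so that both sides vanish on them.\<close>
theorem nn_integral_det_gram_powr:
  fixes I :: "'n::finite set" and s :: real
  assumes "0 < s" "s + real (card I) < real (CARD('m)) + 1"
  shows "(\<integral>\<^sup>+\<phi>. ennreal ((\<Prod>i\<in>I. exp (- (norm (\<phi> i))\<^sup>2)) * Re (det (gram I \<phi>)) powr - s)
      \<partial>PiM I (\<lambda>_. lborel :: (complex^'m) measure)) =
    ennreal (\<Prod>l<card I. pi ^ CARD('m) * Gamma (real (CARD('m)) - real l - s) / Gamma (real (CARD('m)) - real l))"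
  using finite[of I] assms
proof (induction I rule: finite_induct)
  case empty
  have "gram {} \<phi> = mat 1" for \<phi> :: "'n \<Rightarrow> complex^'m" by (simp add: gram_def mat_def vec_eq_iff)
  then show ?case by (simp add: det_I PiM_empty)
next
  case (insert a I)
  interpret product_sigma_finite "\<lambda>_::'n. lborel :: (complex^'m) measure" ..
  let ?m = "real (CARD('m))" and ?l = "real (card I)"
  let ?f = "\<lambda>I (\<phi> :: 'n \<Rightarrow> complex^'m). (\<Prod>i\<in>I. exp (- (norm (\<phi> i))\<^sup>2)) * Re (det (gram I \<phi>)) powr - s"
  let ?c = "pi ^ CARD('m) * Gamma (?m - ?l - s) / Gamma (?m - ?l)"
  have s: "0 < s" "s < ?m - ?l" using insert by auto
  have dim: "real (DIM(complex^'m)) = 2 * ?m" by simp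
  have "(\<integral>\<^sup>+\<phi>. ennreal (?f (insert a I) \<phi>) \<partial>PiM (insert a I) (\<lambda>_. lborel)) =
      (\<integral>\<^sup>+\<phi>. \<integral>\<^sup>+y. ennreal (?f (insert a I) (\<phi>(a := y))) \<partial>lborel \<partial>PiM I (\<lambda>_. lborel))"
    by (rule product_nn_integral_insert) (use insert in \<open>simp_all, measurable\<close>)
  also have "\<dots> = (\<integral>\<^sup>+\<phi>. ennreal (?f I \<phi>) * ennreal ?c \<partial>PiM I (\<lambda>_. lborel))"
  proof (rule nn_integral_cong)
    fix \<phi> :: "'n \<Rightarrow> complex^'m"
    obtain B where B: "orthonormal B" "span B = cspan I \<phi>" "card B = dim (cspan I \<phi>)"
      using orthonormal_basis_cspan by metis
    obtain d where d: "0 \<le> d" "det (gram I \<phi>) = complex_of_real d" using det_gram_real_nonneg by metis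
    have "cspan I (\<phi>(a := y)) = cspan I \<phi>" "gram I (\<phi>(a := y)) = gram I \<phi>" for y
    proof -
      have "(\<Sum>i\<in>I. c i *s (\<phi>(a := y)) i) = (\<Sum>i\<in>I. c i *s \<phi> i)" for c
        using insert by (intro sum.cong) auto
      then show "cspan I (\<phi>(a := y)) = cspan I \<phi>" by (simp add: cspan_def)
      show "gram I (\<phi>(a := y)) = gram I \<phi>" using insert by (auto simp: gram_def vec_eq_iff)
    qed
    then have det: "det (gram (insert a I) (\<phi>(a := y))) = complex_of_real (residual_square B y * d)" for y
      using det_gram_insert[OF insert(2) B(1), of "\<phi>(a := y)"] B d by simp
    have "(\<Prod>i\<in>insert a I. exp (- (norm ((\<phi>(a := y)) i))\<^sup>2)) =
        exp (- (norm y)\<^sup>2) * (\<Prod>i\<in>I. exp (- (norm (\<phi> i))\<^sup>2))" for y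
      using insert by (simp, intro prod.cong) auto
    then have f: "?f (insert a I) (\<phi>(a := y)) = ?f I \<phi> * (exp (- (norm y)\<^sup>2) * residual_square B y powr - s)" for y
      using d residual_square_nonneg[OF B(1), of y] by (simp add: det powr_mult)
    show "(\<integral>\<^sup>+y. ennreal (?f (insert a I) (\<phi>(a := y))) \<partial>lborel) = ennreal (?f I \<phi>) * ennreal ?c"
    proof (cases "d = 0")
      case True
      then show ?thesis unfolding f using d by simp
    next
      case False
      then have "card B = 2 * card I" using d B(3) by (simp add: dim_cspan_if_det_gram)
      then have b: "(real (DIM(complex^'m)) - real (card B)) / 2 = ?m - ?l"
        unfolding dim by simp
      have "(\<integral>\<^sup>+y. ennreal (exp (- (norm y)\<^sup>2) * residual_square B y powr - s) \<partial>lborel) = ennreal ?c"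
        using nn_integral_residual_powr[OF B(1), of s] s unfolding b by (simp add: dim powr_realpow)
      moreover have "residual_square B \<in> borel_measurable borel"
        unfolding residual_square_def[abs_def] by measurable
      ultimately show ?thesis
        unfolding f by (subst ennreal_mult', simp add: prod_nonneg, subst nn_integral_cmult) auto
    qed
  qed
  also have "\<dots> = (\<integral>\<^sup>+\<phi>. ennreal (?f I \<phi>) \<partial>PiM I (\<lambda>_. lborel)) * ennreal ?c"
    by (rule nn_integral_multc) measurable
  also have "\<dots> = ennreal (\<Prod>l<card (insert a I). pi ^ CARD('m) * Gamma (?m - real l - s) / Gamma (?m - real l))"
  proof -
    have "0 \<le> (\<Prod>l<card I. pi ^ CARD('m) * Gamma (?m - real l - s) / Gamma (?m - real l))"
      using s by (intro prod_nonneg divide_nonneg_pos mult_nonneg_nonneg) (auto intro!: less_imp_le[OF Gamma_real_pos])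
    then show ?thesis using insert s
      by (simp only: card_insert_disjoint lessThan_Suc prod.insert) (simp add: mult.commute flip: ennreal_mult')
  qed
  finally show ?case .
qed

section \<open>Lebesgue measure on complex matrices and linear substitutions\<close>

lemma prod_Basis_vec:
  fixes h :: "'v::euclidean_space ^ 'i \<Rightarrow> 'c::comm_monoid_mult"
  shows "(\<Prod>B\<in>Basis. h B) = (\<Prod>i\<in>UNIV. \<Prod>b\<in>Basis. h (axis i b))"
proof -
  have inj: "inj_on (\<lambda>(i, b). axis i b) (UNIV \<times> (Basis :: 'v set))"
    by (auto simp: inj_on_def axis_eq_axis)
  have "(Basis :: ('v^'i) set) = (\<lambda>(i, b). axis i b) ` (UNIV \<times> Basis)"
    unfolding Basis_vec_def by auto
  then show ?thesis
    using prod.reindex[OF inj, of h] by (simp add: prod.cartesian_product split_def comp_def)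
qed

lemma measurable_vec_lambda[measurable]:
  fixes f :: "'i::finite \<Rightarrow> 'a \<Rightarrow> 'v::euclidean_space"
  assumes [measurable]: "\<And>i. f i \<in> borel_measurable M"
  shows "(\<lambda>x. \<chi> i. f i x) \<in> borel_measurable M"
proof -
  have "(\<lambda>x. (\<chi> i. f i x) \<bullet> b) \<in> borel_measurable M" if "b \<in> Basis" for b
    using that unfolding Basis_vec_def by (auto simp: inner_axis)
  then show ?thesis by (subst borel_measurable_euclidean_space) auto
qed

lemma lborel_vec_rows:
  "distr (PiM UNIV (\<lambda>_::'i::finite. lborel :: 'v::euclidean_space measure)) borel (\<lambda>\<phi>. \<chi> i. \<phi> i) = lborel"
proof (rule lborel_eqI[symmetric])
  interpret product_sigma_finite "\<lambda>_::'i. lborel :: 'v measure" ..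
  fix l u :: "'v^'i" assume le: "\<And>b. b \<in> Basis \<Longrightarrow> l \<bullet> b \<le> u \<bullet> b"
  have le': "l $ i \<bullet> b \<le> u $ i \<bullet> b" if "b \<in> Basis" for i b
    using le[of "axis i b"] that unfolding Basis_vec_def inner_axis by blast
  have "(\<lambda>\<phi>. \<chi> i. \<phi> i) -` box l u \<inter> space (PiM UNIV (\<lambda>_::'i. lborel :: 'v measure)) =
      PiE UNIV (\<lambda>i. box (l $ i) (u $ i))"
    by (auto simp: space_PiM box_def Basis_vec_def inner_axis)
  then show "emeasure (distr (PiM UNIV (\<lambda>_::'i. lborel :: 'v measure)) borel (\<lambda>\<phi>. \<chi> i. \<phi> i)) (box l u) =
      ennreal (\<Prod>b\<in>Basis. (u - l) \<bullet> b)"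
    using le' by (simp add: emeasure_distr emeasure_PiM emeasure_lborel_box_eq prod_Basis_vec
        inner_axis inner_diff_left prod_ennreal prod_nonneg)
qed simp

text \<open>The law of a random matrix is given through its columns, whereas its determinant is computed row by row.
This lemma and the previous one translate between both descriptions of the Lebesgue measure.\<close>
lemma lborel_vec_columns:
  "distr (PiM UNIV (\<lambda>_::'j::finite. lborel :: ('v::euclidean_space^'i) measure)) borel (\<lambda>\<phi>. \<chi> i j. \<phi> j $ i)
    = (lborel :: ('v^'j^'i) measure)"
proof (rule lborel_eqI[symmetric])
  interpret product_sigma_finite "\<lambda>_::'j. lborel :: ('v^'i) measure" ..
  fix l u :: "'v^'j^'i" assume le: "\<And>b. b \<in> Basis \<Longrightarrow> l \<bullet> b \<le> u \<bullet> b"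
  have le': "l $ i $ j \<bullet> b \<le> u $ i $ j \<bullet> b" if "b \<in> Basis" for i j b
    using le[of "axis i (axis j b)"] that by (auto simp: inner_axis Basis_vec_def)
  have "(\<lambda>\<phi>. \<chi> i j. \<phi> j $ i) -` box l u \<inter> space (PiM UNIV (\<lambda>_::'j. lborel :: ('v^'i) measure)) =
      PiE UNIV (\<lambda>j. box (\<chi> i. l $ i $ j) (\<chi> i. u $ i $ j))"
    by (auto simp: space_PiM box_def Basis_vec_def inner_axis)
  moreover have "\<forall>b\<in>Basis. (\<chi> i. l $ i $ j) \<bullet> b \<le> (\<chi> i. u $ i $ j) \<bullet> b" for j
    using le' by (auto simp: Basis_vec_def inner_axis)
  moreover have "(\<Prod>i\<in>UNIV. \<Prod>j\<in>UNIV. \<Prod>b\<in>Basis. (u $ i $ j - l $ i $ j) \<bullet> b) =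
      (\<Prod>j\<in>UNIV. \<Prod>i\<in>UNIV. \<Prod>b\<in>Basis. (u $ i $ j - l $ i $ j) \<bullet> b)"
    by (rule prod.swap)
  ultimately show "emeasure (distr (PiM UNIV (\<lambda>_::'j. lborel :: ('v^'i) measure)) borel (\<lambda>\<phi>. \<chi> i j. \<phi> j $ i)) (box l u) =
      ennreal (\<Prod>b\<in>Basis. (u - l) \<bullet> b)"
    using le' by (simp add: emeasure_distr emeasure_PiM emeasure_lborel_box_eq prod_Basis_vec
        inner_axis inner_diff_left prod_ennreal prod_nonneg)
qed simp

lemma nn_integral_lborel_rows:
  fixes f :: "'v::euclidean_space^'i \<Rightarrow> ennreal"
  assumes "f \<in> borel_measurable borel"
  shows "(\<integral>\<^sup>+X. f X \<partial>lborel) = (\<integral>\<^sup>+\<phi>. f (\<chi> i. \<phi> i) \<partial>PiM UNIV (\<lambda>_. lborel))"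
proof -
  have "(\<integral>\<^sup>+X. f X \<partial>lborel) = (\<integral>\<^sup>+X. f X \<partial>distr (PiM UNIV (\<lambda>_. lborel)) borel (\<lambda>\<phi>. \<chi> i. \<phi> i))"
    by (simp only: lborel_vec_rows)
  also have "\<dots> = (\<integral>\<^sup>+\<phi>. f (\<chi> i. \<phi> i) \<partial>PiM UNIV (\<lambda>_. lborel))"
    by (rule nn_integral_distr) (use assms in measurable)
  finally show ?thesis .
qed

lemma nn_integral_lborel_split_row:
  fixes f :: "'v::euclidean_space^'i \<Rightarrow> ennreal"
  assumes [measurable]: "f \<in> borel_measurable borel"
  shows "(\<integral>\<^sup>+X. f X \<partial>lborel) =
    (\<integral>\<^sup>+\<phi>. \<integral>\<^sup>+y. f (\<chi> i. if i = a then y else \<phi> i) \<partial>lborel \<partial>PiM (UNIV - {a}) (\<lambda>_. lborel))"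
proof -
  interpret product_sigma_finite "\<lambda>_::'i. lborel :: 'v measure" ..
  have U: "UNIV = insert a (UNIV - {a})" by auto
  have "(\<integral>\<^sup>+X. f X \<partial>lborel) = (\<integral>\<^sup>+\<phi>. f (\<chi> i. \<phi> i) \<partial>PiM (insert a (UNIV - {a})) (\<lambda>_. lborel))"
    using nn_integral_lborel_rows[OF assms] by (simp flip: U)
  also have "\<dots> = (\<integral>\<^sup>+\<phi>. \<integral>\<^sup>+y. f (\<chi> i. (\<phi>(a := y)) i) \<partial>lborel \<partial>PiM (UNIV - {a}) (\<lambda>_. lborel))"
    by (rule product_nn_integral_insert) (simp_all flip: U)
  finally show ?thesis by (simp add: fun_upd_def)
qed

lemma herm_form_eq_sum: "herm_form A z = (\<Sum>i\<in>UNIV. \<Sum>j\<in>UNIV. cnj (z $ i) * A $ i $ j * z $ j)"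
  by (simp add: herm_form_def matrix_vector_mult_def sum_distrib_left mult.assoc)

lemma herm_form_congruence:
  "herm_form (cadjoint E ** A ** E) w = herm_form A (E *v w)"
proof -
  have "(cadjoint E *v u) $ i = (\<Sum>k\<in>UNIV. cnj (E $ k $ i) * u $ k)" for u i
    by (simp add: cadjoint_def matrix_vector_mult_def)
  moreover have "(cadjoint E ** A ** E) *v w = cadjoint E *v (A *v (E *v w))"
    by (simp add: matrix_vector_mul_assoc matrix_mul_assoc)
  ultimately have "herm_form (cadjoint E ** A ** E) w =
      (\<Sum>i\<in>UNIV. cnj (w $ i) * (\<Sum>k\<in>UNIV. cnj (E $ k $ i) * (A *v (E *v w)) $ k))"
    by (simp add: herm_form_def)
  also have "\<dots> = (\<Sum>k\<in>UNIV. cnj ((E *v w) $ k) * (A *v (E *v w)) $ k)"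
    unfolding sum_distrib_left
    by (subst sum.swap) (simp add: matrix_vector_mult_def[of E w] sum_distrib_right mult_ac)
  finally show ?thesis by (simp add: herm_form_def)
qed

lemma herm_form_mat_1: "herm_form (mat 1) z = complex_of_real ((norm z)\<^sup>2)"
  by (simp add: herm_form_def norm_vec_def L2_set_def sum_nonneg complex_norm_square[symmetric] mult.commute)

lemma cadjoint_mult: "cadjoint (A ** B) = cadjoint B ** cadjoint A"
  by (simp add: cadjoint_def matrix_matrix_mult_def vec_eq_iff mult.commute)

lemma cadjoint_mat_1: "cadjoint (mat 1) = mat 1"
  by (simp add: cadjoint_def mat_def vec_eq_iff)

lemma det_cadjoint: "det (cadjoint A) = cnj (det A)"
proof -
  have "cnj (det A) = det (\<chi> i j. cnj (A $ i $ j))"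
    by (simp add: det_def)
  also have "\<dots> = det (transpose (\<chi> i j. cnj (A $ i $ j)))"
    by (rule det_transpose[symmetric])
  finally show ?thesis by (simp add: transpose_def cadjoint_def)
qed

text \<open>The complex matrix \<open>B\<close> acts on each of the \<open>CARD('m)\<close> columns of \<open>X\<close>, and its real Jacobian on one column is
the square of \<open>cmod (det B)\<close>. The property is inherited by products, so it extends from single row
operations to the factors of a positive definite matrix constructed below.\<close>
definition scales_volume :: "'m::finite itself \<Rightarrow> complex^'n^'n \<Rightarrow> bool"
  where "scales_volume T B \<longleftrightarrow> det B \<noteq> 0 \<and> (\<forall>f \<in> borel_measurable (borel :: (complex^'m^'n) measure).
    ennreal (cmod (det B) ^ (2 * CARD('m))) * (\<integral>\<^sup>+X. f (B ** X) \<partial>lborel) = (\<integral>\<^sup>+X. f X \<partial>lborel))"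

lemma scales_volumeD:
  fixes f :: "complex^'m^'n \<Rightarrow> ennreal"
  assumes "scales_volume TYPE('m) B" "f \<in> borel_measurable borel"
  shows "ennreal (cmod (det B) ^ (2 * CARD('m))) * (\<integral>\<^sup>+X. f (B ** X) \<partial>lborel) = (\<integral>\<^sup>+X. f X \<partial>lborel)"
  using assms unfolding scales_volume_def by auto

lemma measurable_matrix_mult_left [measurable]:
  fixes B :: "complex^'n^'n"
  shows "(\<lambda>X :: complex^'m^'n. B ** X) \<in> borel_measurable borel"
  unfolding matrix_matrix_mult_def by measurable

lemma scales_volume_mult:
  fixes A B :: "complex^'n^'n"
  assumes A: "scales_volume TYPE('m::finite) A" and B: "scales_volume TYPE('m::finite) B"
  shows "scales_volume TYPE('m::finite) (A ** B)"
  unfolding scales_volume_def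
proof (intro conjI ballI)
  show "det (A ** B) \<noteq> 0" using A B by (simp add: scales_volume_def det_mul)
  fix f :: "complex^'m^'n \<Rightarrow> ennreal" assume f[measurable]: "f \<in> borel_measurable borel"
  have "(\<lambda>X. f (A ** X)) \<in> borel_measurable borel" by measurable
  then have "ennreal (cmod (det B) ^ (2 * CARD('m))) * (\<integral>\<^sup>+X. f (A ** (B ** X)) \<partial>lborel) =
      (\<integral>\<^sup>+X. f (A ** X) \<partial>lborel)"
    by (rule scales_volumeD[OF B])
  moreover have "ennreal (cmod (det A) ^ (2 * CARD('m))) * (\<integral>\<^sup>+X. f (A ** X) \<partial>lborel) = (\<integral>\<^sup>+X. f X \<partial>lborel)"
    by (rule scales_volumeD[OF A f])
  ultimately show "ennreal (cmod (det (A ** B)) ^ (2 * CARD('m))) * (\<integral>\<^sup>+X. f ((A ** B) ** X) \<partial>lborel) = (\<integral>\<^sup>+X. f X \<partial>lborel)"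
    by (simp add: det_mul norm_mult power_mult_distrib ennreal_mult' mult.assoc matrix_mul_assoc[symmetric])
qed

text \<open>The identity matrix with row \<open>a\<close> replaced by \<open>v\<close>.\<close>
definition row_shear :: "'n::finite \<Rightarrow> complex^'n \<Rightarrow> complex^'n^'n"
  where "row_shear a v = (\<chi> i. if i = a then v else axis i 1)"

lemma det_row_shear: "det (row_shear a v) = v $ a"
proof -
  have "det (row_shear a v) = det (transpose (row_shear a v))" by simp
  also have "\<dots> = det (\<chi> i j. if i = j then if i = a then v $ a else 1 else 0)"
    by (rule det_axis_row_cong[of a]) (auto simp: transpose_def row_shear_def axis_def)
  also have "\<dots> = v $ a"
    by (subst det_diagonal) auto
  finally show ?thesis .
qed

lemma row_shear_mult_vec: "row_shear a v *v z = (\<chi> i. if i = a then \<Sum>j\<in>UNIV. v $ j * z $ j else z $ i)"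
proof -
  have "(\<Sum>j\<in>UNIV. axis i 1 $ j * z $ j) = z $ i" for i
    by (simp add: axis_def if_distrib[of "\<lambda>c. c * _"] cong: if_cong)
  then show ?thesis
    by (simp add: vec_eq_iff row_shear_def matrix_vector_mult_def)
qed

text \<open>Only row \<open>a\<close> of the matrix changes, by a dilation and a translation that depends on the other rows. By Tonelli's
theorem the claim reduces to an affine substitution in that row.\<close>
lemma scales_volume_row_shear:
  fixes v :: "complex^'n"
  assumes \<alpha>: "0 < \<alpha>" "v $ a = complex_of_real \<alpha>"
  shows "scales_volume TYPE('m::finite) (row_shear a v)"
  unfolding scales_volume_def
proof (intro conjI ballI)
  show "det (row_shear a v) \<noteq> 0" using \<alpha> by (simp add: det_row_shear)
  fix f :: "complex^'m^'n \<Rightarrow> ennreal" assume f[measurable]: "f \<in> borel_measurable borel"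
  define w where "w = (\<lambda>\<phi> :: 'n \<Rightarrow> complex^'m. \<Sum>j\<in>UNIV - {a}. v $ j *s \<phi> j)"
  have mult: "row_shear a v ** (\<chi> i. if i = a then y else \<phi> i) =
      (\<chi> i. if i = a then w \<phi> + \<alpha> *\<^sub>R y else \<phi> i)" for y and \<phi> :: "'n \<Rightarrow> complex^'m"
  proof -
    have "(\<Sum>j\<in>UNIV. axis i 1 $ j * (if j = a then y else \<phi> j) $ k) = (if i = a then y else \<phi> i) $ k" for i k
      by (simp add: axis_def if_distrib[of "\<lambda>c. c * _"] cong: if_cong)
    moreover have "(\<Sum>j\<in>UNIV. v $ j * (if j = a then y else \<phi> j) $ k) = (w \<phi> + \<alpha> *\<^sub>R y) $ k" for k
    proof -
      have "(\<Sum>j\<in>UNIV. v $ j * (if j = a then y else \<phi> j) $ k) =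
          v $ a * y $ k + (\<Sum>j\<in>UNIV - {a}. v $ j * (if j = a then y else \<phi> j) $ k)"
        by (subst sum.remove[of _ a]) auto
      also have "(\<Sum>j\<in>UNIV - {a}. v $ j * (if j = a then y else \<phi> j) $ k) = (\<Sum>j\<in>UNIV - {a}. v $ j * \<phi> j $ k)"
        by (rule sum.cong) auto
      finally show ?thesis
        by (simp add: w_def \<alpha>) (simp add: scaleR_conv_of_real)
    qed
    ultimately show ?thesis
      by (simp add: vec_eq_iff matrix_matrix_mult_def row_shear_def)
  qed
  have m: "(\<lambda>X. f (row_shear a v ** X)) \<in> borel_measurable borel" by measurable
  let ?c = "ennreal (cmod (det (row_shear a v)) ^ (2 * CARD('m)))"
  have c: "?c = ennreal (\<bar>\<alpha>\<bar> ^ DIM(complex^'m))"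
    using \<alpha> by (simp add: det_row_shear mult.commute)
  have inner: "?c * (\<integral>\<^sup>+y. f (\<chi> i. if i = a then w \<phi> + \<alpha> *\<^sub>R y else \<phi> i) \<partial>lborel) =
      (\<integral>\<^sup>+y. f (\<chi> i. if i = a then y else \<phi> i) \<partial>lborel)" for \<phi> :: "'n \<Rightarrow> complex^'m"
  proof -
    have "(\<lambda>y. f (\<chi> i. if i = a then y else \<phi> i)) \<in> borel_measurable borel" by measurable
    from nn_integral_lborel_affine[OF this, of \<alpha> "w \<phi>"] show ?thesis
      using \<alpha> unfolding c by simp
  qed
  have [measurable]: "(\<lambda>\<phi>. w \<phi>) \<in> borel_measurable (PiM (UNIV - {a}) (\<lambda>_. lborel))"
  proof -
    have "(\<lambda>\<phi>. \<chi> k. \<Sum>j\<in>UNIV - {a}. v $ j * \<phi> j $ k) \<in> borel_measurable (PiM (UNIV - {a}) (\<lambda>_. lborel :: (complex^'m) measure))"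
      by measurable
    moreover have "w = (\<lambda>\<phi>. \<chi> k. \<Sum>j\<in>UNIV - {a}. v $ j * \<phi> j $ k)"
      by (simp add: fun_eq_iff w_def vec_eq_iff)
    ultimately show ?thesis by simp
  qed
  have "(\<lambda>p. \<chi> i. if i = a then w (fst p) + \<alpha> *\<^sub>R snd p else fst p i) \<in>
      borel_measurable (PiM (UNIV - {a}) (\<lambda>_. lborel :: (complex^'m) measure) \<Otimes>\<^sub>M lborel)"
  proof (rule measurable_vec_lambda)
    fix i
    show "(\<lambda>p. if i = a then w (fst p) + \<alpha> *\<^sub>R snd p else fst p i) \<in>
        borel_measurable (PiM (UNIV - {a}) (\<lambda>_. lborel :: (complex^'m) measure) \<Otimes>\<^sub>M lborel)"
      by (cases "i = a") (simp_all, measurable)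
  qed
  then have "(\<lambda>(\<phi>, y). f (\<chi> i. if i = a then w \<phi> + \<alpha> *\<^sub>R y else \<phi> i)) \<in>
      borel_measurable (PiM (UNIV - {a}) (\<lambda>_. lborel :: (complex^'m) measure) \<Otimes>\<^sub>M lborel)"
    unfolding split_def by (rule measurable_compose) measurable
  then have m2: "(\<lambda>\<phi>. \<integral>\<^sup>+y. f (\<chi> i. if i = a then w \<phi> + \<alpha> *\<^sub>R y else \<phi> i) \<partial>lborel) \<in>
      borel_measurable (PiM (UNIV - {a}) (\<lambda>_. lborel :: (complex^'m) measure))"
    by (rule lborel.borel_measurable_nn_integral)
  show "?c * (\<integral>\<^sup>+X. f (row_shear a v ** X) \<partial>lborel) = (\<integral>\<^sup>+X. f X \<partial>lborel)"
    unfolding nn_integral_lborel_split_row[OF f, of a] nn_integral_lborel_split_row[OF m, of a] mult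
    by (subst nn_integral_cmult[symmetric]) (simp_all add: inner m2)
qed

lemma scales_volume_mat_1: "scales_volume TYPE('m::finite) (mat 1 :: complex^'n^'n)"
  by (simp add: scales_volume_def det_I)

text \<open>This is the Cholesky factorization. It proceeds by completing one square at a time: each step splits off a row operation with a
positive diagonal entry, so that the factor is a product of substitutions with a known Jacobian. In the
induction, \<open>I\<close> contains the indices whose row and column have not been cleared yet.\<close>
theorem positive_definite_factorization:
  fixes A :: "complex^'n^'n"
  assumes "positive_definite A"
  shows "\<exists>B. A = cadjoint B ** B \<and> scales_volume TYPE('m::finite) B"
proof -
  have "\<exists>B. A = cadjoint B ** B \<and> scales_volume TYPE('m::finite) B"
    if "positive_definite A" "\<forall>i j. i \<notin> I \<or> j \<notin> I \<longrightarrow> A $ i $ j = (if i = j then 1 else 0)"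
    for I :: "'n set" and A :: "complex^'n^'n"
    using finite[of I] that
  proof (induction I arbitrary: A rule: finite_induct)
    case empty
    then have "A = mat 1" by (simp add: vec_eq_iff mat_def)
    then show ?case
      using scales_volume_mat_1 by (intro exI[of _ "mat 1"]) (simp add: cadjoint_mat_1)
  next
    case (insert a I)
    have herm: "cnj (A $ j $ i) = A $ i $ j" for i j
    proof -
      have "cadjoint A = A" using insert.prems by (simp add: positive_definite_def)
      then have "cadjoint A $ i $ j = A $ i $ j" by simp
      then show ?thesis by (simp add: cadjoint_def)
    qed
    define d where "d = Re (A $ a $ a)"
    have A_aa: "A $ a $ a = complex_of_real d"
      using herm[of a a] by (simp add: d_def complex_eq_iff)
    have d: "0 < d"
    proof -
      have "herm_form A (axis a 1) = A $ a $ a"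
        by (simp add: herm_form_eq_sum axis_def if_distrib[of cnj] if_distrib[of "\<lambda>c. c * _"]
            if_distrib[of "\<lambda>c. _ * c"] cong: if_cong)
      moreover have "axis a 1 \<noteq> (0 :: complex^'n)" by simp
      ultimately show ?thesis
        using insert.prems by (metis positive_definite_def d_def)
    qed
    define \<alpha> where "\<alpha> = sqrt d"
    have \<alpha>: "0 < \<alpha>" "\<alpha> * \<alpha> = d" using d by (simp_all add: \<alpha>_def)
    define v where "v = (\<chi> j. A $ a $ j / complex_of_real \<alpha>)"
    define E where "E = row_shear a v"
    \<comment> \<open>The Schur complement of the entry at \<open>a\<close>, completed by the identity.\<close>
    define A' where "A' = (\<chi> i j. if i = a \<or> j = a then if i = j then 1 else 0
      else A $ i $ j - A $ i $ a * A $ a $ j / complex_of_real d)"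
    have v_a: "v $ a = complex_of_real \<alpha>"
      using \<alpha> by (simp add: v_def A_aa flip: of_real_divide of_real_mult \<alpha>(2))
    have A_eq: "A = cadjoint E ** A' ** E"
    proof -
      have "(cadjoint E ** A' ** E) $ i $ j = A $ i $ j" for i j
      proof -
        have dd: "complex_of_real d = complex_of_real \<alpha> * complex_of_real \<alpha>"
          using \<alpha> by (simp flip: of_real_mult)
        have E: "E $ k $ i = (if k = a then v $ i else if k = i then 1 else 0)" for k i
          by (simp add: E_def row_shear_def axis_def)
        have "(\<Sum>k\<in>UNIV. cnj (E $ k $ i) * A' $ k $ l) =
            cnj (v $ i) * A' $ a $ l + (if i = a then 0 else A' $ i $ l)" for l
        proof -
          have "(\<Sum>k\<in>UNIV. cnj (E $ k $ i) * A' $ k $ l) = cnj (E $ a $ i) * A' $ a $ l +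
              (\<Sum>k\<in>UNIV - {a}. cnj (E $ k $ i) * A' $ k $ l)"
            by (rule sum.remove) auto
          also have "(\<Sum>k\<in>UNIV - {a}. cnj (E $ k $ i) * A' $ k $ l) =
              (\<Sum>k\<in>UNIV - {a}. if k = i then A' $ k $ l else 0)"
            by (intro sum.cong) (auto simp: E)
          finally show ?thesis by (simp add: E)
        qed
        then have "(cadjoint E ** A' ** E) $ i $ j =
            (\<Sum>l\<in>UNIV. (cnj (v $ i) * A' $ a $ l + (if i = a then 0 else A' $ i $ l)) * E $ l $ j)"
          by (simp add: matrix_matrix_mult_def cadjoint_def)
        moreover have "(\<Sum>l\<in>UNIV. (cnj (v $ i) * A' $ a $ l + (if i = a then 0 else A' $ i $ l)) * E $ l $ j) =
            (cnj (v $ i) * A' $ a $ a + (if i = a then 0 else A' $ i $ a)) * E $ a $ j +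
            (\<Sum>l\<in>UNIV - {a}. (cnj (v $ i) * A' $ a $ l + (if i = a then 0 else A' $ i $ l)) * E $ l $ j)"
          by (rule sum.remove) auto
        moreover have "(\<Sum>l\<in>UNIV - {a}. (cnj (v $ i) * A' $ a $ l + (if i = a then 0 else A' $ i $ l)) * E $ l $ j) =
            (\<Sum>l\<in>UNIV - {a}. if l = j then cnj (v $ i) * A' $ a $ l + (if i = a then 0 else A' $ i $ l) else 0)"
          by (intro sum.cong) (auto simp: E)
        ultimately have "(cadjoint E ** A' ** E) $ i $ j = cnj (v $ i) * v $ j + (if i = a \<or> j = a then 0 else A' $ i $ j)"
          by (simp add: A'_def E)
        also have "\<dots> = A $ i $ j"
          using \<alpha> d A_aa by (auto simp: A'_def v_def herm dd)
        finally show ?thesis .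
      qed
      then show ?thesis by (simp add: vec_eq_iff)
    qed
    have "positive_definite A'"
      unfolding positive_definite_def
    proof (intro conjI allI impI)
      show "cadjoint A' = A'"
        by (auto simp: cadjoint_def vec_eq_iff A'_def herm mult.commute)
      fix z :: "complex^'n" assume z: "z \<noteq> 0"
      \<comment> \<open>The preimage of \<open>z\<close> under \<open>E\<close>.\<close>
      define w where "w = (\<chi> i. if i = a then (z $ a - (\<Sum>j\<in>UNIV - {a}. v $ j * z $ j)) / complex_of_real \<alpha> else z $ i)"
      have "(\<Sum>j\<in>UNIV. v $ j * w $ j) = v $ a * w $ a + (\<Sum>j\<in>UNIV - {a}. v $ j * z $ j)"
        by (subst sum.remove[of _ a]) (auto simp: w_def intro!: sum.cong)
      also have "\<dots> = z $ a" using \<alpha> v_a by (simp add: w_def)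
      finally have Ew: "E *v w = z"
        unfolding E_def row_shear_mult_vec by (simp add: vec_eq_iff w_def)
      with z have "w \<noteq> 0" by auto
      then have "0 < Re (herm_form A w)" using insert.prems by (simp add: positive_definite_def)
      then show "0 < Re (herm_form A' z)"
        by (simp add: A_eq herm_form_congruence Ew)
    qed
    moreover have "\<forall>i j. i \<notin> I \<or> j \<notin> I \<longrightarrow> A' $ i $ j = (if i = j then 1 else 0)"
      using insert.prems by (auto simp: A'_def)
    ultimately obtain B where B: "A' = cadjoint B ** B" "scales_volume TYPE('m::finite) B"
      using insert.IH by blast
    then show ?case
      using scales_volume_mult[OF B(2) scales_volume_row_shear[OF \<alpha>(1) v_a]]
      by (intro exI[of _ "B ** E"]) (simp add: A_eq cadjoint_mult matrix_mul_assoc E_def)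
  qed
  from this[of A UNIV] assms show ?thesis by auto
qed

lemma norm_square_rows: "(norm X)\<^sup>2 = (\<Sum>i\<in>UNIV. (norm (X $ i))\<^sup>2)"
  for X :: "'v::real_normed_vector^'i"
  by (simp add: norm_vec_def L2_set_def sum_nonneg)

lemma norm_square_columns: "(norm X)\<^sup>2 = (\<Sum>j\<in>UNIV. (norm (column j X))\<^sup>2)"
  for X :: "complex^'m^'n"
  by (simp add: norm_square_rows column_def) (rule sum.swap)

lemma column_matrix_mult: "column j (B ** X) = B *v column j X"
  by (simp add: column_def matrix_matrix_mult_def matrix_vector_mult_def)

lemma mult_cadjoint_eq_gram: "X ** cadjoint X = gram UNIV (\<lambda>i. X $ i)"
  by (simp add: vec_eq_iff matrix_matrix_mult_def cadjoint_def gram_def cinner_def)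

lemma det_mult_cadjoint: "det (X ** cadjoint X) = complex_of_real (Re (det (X ** cadjoint X)))"
  and Re_det_mult_cadjoint_nonneg: "0 \<le> Re (det (X ** cadjoint X))"
  using det_gram_real_nonneg[of UNIV "\<lambda>i. X $ i"] unfolding mult_cadjoint_eq_gram by auto

lemma measurable_det_mult_cadjoint [measurable]:
  "(\<lambda>X :: complex^'m^'n. Re (det (X ** cadjoint X))) \<in> borel_measurable borel"
proof -
  have [measurable]: "cnj \<in> borel_measurable borel"
    by (intro borel_measurable_continuous_onI continuous_intros)
  have "(\<lambda>X :: complex^'m^'n. det (X ** cadjoint X)) \<in> borel_measurable borel"
    unfolding det_def matrix_matrix_mult_def cadjoint_def by simp measurable
  then show ?thesis by measurable
qed

lemma measurable_herm_form_column [measurable]: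
  "(\<lambda>X :: complex^'m^'n. herm_form A (column j X)) \<in> borel_measurable borel"
proof -
  have [measurable]: "cnj \<in> borel_measurable borel"
    by (intro borel_measurable_continuous_onI continuous_intros)
  show ?thesis unfolding herm_form_eq_sum column_def by simp measurable
qed

text \<open>Writing \<open>A\<close> as \<open>cadjoint B ** B\<close> and substituting \<open>B ** X\<close> for \<open>X\<close> reduces the claim to the identity matrix: the
quadratic form becomes the squared norm and the Gram determinant picks up the factor \<open>det A\<close>, while the volume is multiplied by
\<open>det A\<close> to the power \<open>CARD('m)\<close>. So \<open>A\<close> enters through a power of its determinant only. The
exponent \<open>s - CARD('m)\<close> is not an integer in general, as for a Wishart law with fractional degrees of freedom.\<close>
theorem nn_integral_det_powr_gaussian:
  fixes A :: "complex^'n^'n" and s :: real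
  assumes A: "positive_definite A"
    and s: "0 < s" "s + real (CARD('n)) < real (CARD('m)) + 1"
  shows "(\<integral>\<^sup>+X. ennreal (exp (- (\<Sum>j\<in>UNIV. Re (herm_form A (column j X)))) *
        Re (det (X ** cadjoint X)) powr - s) \<partial>(lborel :: (complex^'m^'n) measure)) =
    ennreal (Re (det A) powr (s - real (CARD('m))) *
      (\<Prod>l<CARD('n). pi ^ CARD('m) * Gamma (real (CARD('m)) - real l - s) / Gamma (real (CARD('m)) - real l)))"
proof -
  let ?m = "real (CARD('m))"
  let ?D = "\<lambda>X :: complex^'m^'n. Re (det (X ** cadjoint X))"
  let ?K = "\<Prod>l<CARD('n). pi ^ CARD('m) * Gamma (?m - real l - s) / Gamma (?m - real l)"
  obtain B where A_eq: "A = cadjoint B ** B" and B: "scales_volume TYPE('m::finite) B"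
    using positive_definite_factorization[OF A] by blast
  define \<delta> where "\<delta> = (cmod (det B))\<^sup>2"
  have \<delta>: "0 < \<delta>" using B by (simp add: scales_volume_def \<delta>_def)
  have det_A: "det A = complex_of_real \<delta>"
    unfolding A_eq det_mul det_cadjoint \<delta>_def complex_norm_square by (rule mult.commute)
  define f where "f = (\<lambda>X :: complex^'m^'n. ennreal (exp (- (norm X)\<^sup>2) * ?D X powr - s))"
  have f[measurable]: "f \<in> borel_measurable borel" unfolding f_def by measurable
  have f_B: "f (B ** X) = ennreal (\<delta> powr - s) *
      ennreal (exp (- (\<Sum>j\<in>UNIV. Re (herm_form A (column j X)))) * ?D X powr - s)" for X
  proof -
    have "(norm (B ** X))\<^sup>2 = (\<Sum>j\<in>UNIV. Re (herm_form A (column j X)))"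
      using herm_form_congruence[of B "mat 1"]
      by (simp add: norm_square_columns column_matrix_mult A_eq herm_form_mat_1)
    moreover have "?D (B ** X) = \<delta> * ?D X"
    proof -
      have "det ((B ** X) ** cadjoint (B ** X)) = det B * det (X ** cadjoint X) * det (cadjoint B)"
        by (simp add: cadjoint_mult det_mul flip: matrix_mul_assoc) (simp add: det_mul matrix_mul_assoc)
      also have "\<dots> = complex_of_real \<delta> * complex_of_real (?D X)"
        unfolding det_mult_cadjoint[symmetric] det_cadjoint \<delta>_def complex_norm_square
        by (simp only: mult_ac)
      finally show ?thesis by simp
    qed
    ultimately show ?thesis
      using \<delta> Re_det_mult_cadjoint_nonneg[of X] by (simp add: f_def powr_mult mult_ac flip: ennreal_mult')
  qed
  have "(\<integral>\<^sup>+X. f X \<partial>lborel) = ennreal ?K"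
  proof -
    have "(\<integral>\<^sup>+X. f X \<partial>lborel) = (\<integral>\<^sup>+\<phi>. f (\<chi> i. \<phi> i) \<partial>PiM UNIV (\<lambda>_. lborel))"
      by (rule nn_integral_lborel_rows) measurable
    also have "\<dots> = (\<integral>\<^sup>+\<phi>. ennreal ((\<Prod>i\<in>UNIV. exp (- (norm (\<phi> i))\<^sup>2)) * Re (det (gram (UNIV :: 'n set) \<phi>)) powr - s)
        \<partial>PiM UNIV (\<lambda>_. lborel :: (complex^'m) measure))"
    proof (intro nn_integral_cong)
      fix \<phi> :: "'n \<Rightarrow> complex^'m"
      have "gram UNIV (($) (vec_lambda \<phi>)) = gram UNIV \<phi>" by (simp add: gram_def)
      then show "f (\<chi> i. \<phi> i) = ennreal ((\<Prod>i\<in>UNIV. exp (- (norm (\<phi> i))\<^sup>2)) * Re (det (gram UNIV \<phi>)) powr - s)"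
        unfolding f_def norm_square_rows[of "vec_lambda \<phi>"] mult_cadjoint_eq_gram
        by (simp only: sum_negf[symmetric] exp_sum finite vec_lambda_beta)
    qed
    finally show ?thesis
      using nn_integral_det_gram_powr[of s "UNIV :: 'n set", where 'm='m] s by simp
  qed
  moreover have "ennreal (cmod (det B) ^ (2 * CARD('m))) * (\<integral>\<^sup>+X. f (B ** X) \<partial>lborel) = (\<integral>\<^sup>+X. f X \<partial>lborel)"
    by (rule scales_volumeD[OF B f])
  moreover have "cmod (det B) ^ (2 * CARD('m)) = \<delta> powr ?m"
    using \<delta> by (simp add: \<delta>_def power_mult powr_realpow)
  moreover have "(\<integral>\<^sup>+X. f (B ** X) \<partial>lborel) = ennreal (\<delta> powr - s) *
      (\<integral>\<^sup>+X. ennreal (exp (- (\<Sum>j\<in>UNIV. Re (herm_form A (column j X)))) * ?D X powr - s) \<partial>lborel)"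
  proof -
    have "(\<lambda>X. ennreal (exp (- (\<Sum>j\<in>UNIV. Re (herm_form A (column j X)))) * ?D X powr - s)) \<in> borel_measurable borel"
      by measurable
    then show ?thesis unfolding f_B by (intro nn_integral_cmult) simp
  qed
  ultimately have "ennreal (\<delta> powr (s - ?m)) * (ennreal (\<delta> powr ?m) * (ennreal (\<delta> powr - s) *
      (\<integral>\<^sup>+X. ennreal (exp (- (\<Sum>j\<in>UNIV. Re (herm_form A (column j X)))) * ?D X powr - s) \<partial>lborel))) =
      ennreal (\<delta> powr (s - ?m)) * ennreal ?K"
    by simp
  moreover have "\<delta> powr (s - ?m) * (\<delta> powr ?m * \<delta> powr - s) = 1"
    using \<delta> by (simp flip: powr_add)
  ultimately show ?thesis
    using \<delta> by (simp add: det_A flip: mult.assoc ennreal_mult')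
qed

section \<open>The law of a complex Gaussian matrix\<close>

lemma density_PiM_prod:
  fixes f :: "'v::euclidean_space \<Rightarrow> ennreal"
  assumes [measurable]: "f \<in> borel_measurable borel" and "prob_space (density lborel f)"
  shows "PiM UNIV (\<lambda>_::'j::finite. density lborel f) =
    density (PiM UNIV (\<lambda>_::'j. lborel)) (\<lambda>\<phi>. \<Prod>j\<in>UNIV. f (\<phi> j))"
proof -
  interpret f: prob_space "density lborel f" by fact
  interpret F: product_sigma_finite "\<lambda>_::'j. density lborel f" ..
  interpret L: product_sigma_finite "\<lambda>_::'j. lborel :: 'v measure" ..
  show ?thesis
  proof (rule F.PiM_eqI[symmetric])
    show "sets (density (PiM UNIV (\<lambda>_::'j. lborel)) (\<lambda>\<phi>. \<Prod>j\<in>UNIV. f (\<phi> j))) = sets (PiM UNIV (\<lambda>_::'j. density lborel f))"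
      by (simp cong: sets_PiM_cong)
    fix A :: "'j \<Rightarrow> 'v set" assume "\<And>i. i \<in> UNIV \<Longrightarrow> A i \<in> sets (density lborel f)"
    then have A[measurable]: "A i \<in> sets borel" for i by simp
    have "PiE UNIV A \<in> sets (PiM UNIV (\<lambda>_::'j. lborel :: 'v measure))"
      by (rule sets_PiM_I_finite) auto
    then have "emeasure (density (PiM UNIV (\<lambda>_::'j. lborel)) (\<lambda>\<phi>. \<Prod>j\<in>UNIV. f (\<phi> j))) (PiE UNIV A) =
        (\<integral>\<^sup>+\<phi>. (\<Prod>j\<in>UNIV. f (\<phi> j)) * indicator (PiE UNIV A) \<phi> \<partial>PiM UNIV (\<lambda>_::'j. lborel))"
      by (rule emeasure_density[rotated]) measurable
    also have "\<dots> = (\<integral>\<^sup>+\<phi>. (\<Prod>j\<in>UNIV. f (\<phi> j) * indicator (A j) (\<phi> j)) \<partial>PiM UNIV (\<lambda>_::'j. lborel))"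
    proof (rule nn_integral_cong)
      fix \<phi> :: "'j \<Rightarrow> 'v"
      have "indicator (PiE UNIV A) \<phi> = (\<Prod>j\<in>UNIV. indicator (A j) (\<phi> j) :: ennreal)"
        by (auto simp: indicator_def PiE_def Pi_def)
      then show "(\<Prod>j\<in>UNIV. f (\<phi> j)) * indicator (PiE UNIV A) \<phi> = (\<Prod>j\<in>UNIV. f (\<phi> j) * indicator (A j) (\<phi> j))"
        by (simp add: prod.distrib)
    qed
    also have "\<dots> = (\<Prod>j\<in>UNIV. \<integral>\<^sup>+y. f y * indicator (A j) y \<partial>lborel)"
      by (rule L.product_nn_integral_prod) auto
    also have "\<dots> = (\<Prod>j\<in>UNIV. emeasure (density lborel f) (A j))"
      by (simp add: emeasure_density)
    finally show "emeasure (density (PiM UNIV (\<lambda>_::'j. lborel)) (\<lambda>\<phi>. \<Prod>j\<in>UNIV. f (\<phi> j))) (PiE UNIV A) =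
        (\<Prod>j\<in>UNIV. emeasure (density lborel f) (A j))" .
  qed simp
qed

lemma columns_vec_lambda: "(\<chi> i j. column j X $ i) = X"
  by (simp add: column_def)

lemma complex_normal_matrix_measurable:
  fixes X :: "'a \<Rightarrow> complex^'m^'n"
  assumes "prob_space M" "complex_normal_matrix M X R"
  shows "X \<in> borel_measurable M"
proof -
  have [measurable]: "(\<lambda>\<omega>. column j (X \<omega>)) \<in> borel_measurable M" for j
  proof -
    have "distributed M lborel (\<lambda>\<omega>. column j (X \<omega>)) (\<lambda>z. ennreal (complex_normal_density R z))"
      using assms(2) by (simp add: complex_normal_matrix_def)
    from distributed_measurable[OF this] show ?thesis by simp
  qed
  have "(\<lambda>\<omega>. \<chi> i j. column j (X \<omega>) $ i) \<in> borel_measurable M"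
    by measurable
  then show ?thesis by (simp add: columns_vec_lambda)
qed

theorem nn_integral_complex_normal_matrix:
  fixes X :: "'a \<Rightarrow> complex^'m^'n"
  assumes M: "prob_space M" and X: "complex_normal_matrix M X R"
    and g[measurable]: "g \<in> borel_measurable borel"
  shows "(\<integral>\<^sup>+\<omega>. g (X \<omega>) \<partial>M) =
    (\<integral>\<^sup>+Z. (\<Prod>j\<in>UNIV. ennreal (complex_normal_density R (column j Z))) * g Z \<partial>lborel)"
proof -
  interpret prob_space M by fact
  let ?f = "\<lambda>z. ennreal (complex_normal_density R z)"
  let ?L = "PiM UNIV (\<lambda>_::'m. lborel :: (complex^'n) measure)"
  have D: "distributed M lborel (\<lambda>\<omega>. column j (X \<omega>)) ?f" for j
    using X by (simp add: complex_normal_matrix_def)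
  have col[measurable]: "(\<lambda>\<omega>. column j (X \<omega>)) \<in> borel_measurable M" for j
    using distributed_measurable[OF D] by simp
  have f[measurable]: "?f \<in> borel_measurable borel"
    using distributed_borel_measurable[OF D] by simp
  have distr: "distr M borel (\<lambda>\<omega>. column j (X \<omega>)) = density lborel ?f" for j
    using distributed_distr_eq_density[OF D, of j] by (simp cong: distr_cong)
  have "prob_space (density lborel ?f)"
    unfolding distr[of undefined, symmetric] by (rule prob_space_distr) measurable
  have "indep_vars (\<lambda>_. borel) (\<lambda>j \<omega>. column j (X \<omega>)) UNIV"
    using X by (simp add: complex_normal_matrix_def)
  then have "distr M (PiM UNIV (\<lambda>_. borel)) (\<lambda>\<omega>. \<lambda>j\<in>UNIV. column j (X \<omega>)) = PiM UNIV (\<lambda>j. distr M borel (\<lambda>\<omega>. column j (X \<omega>)))"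
    by (subst (asm) indep_vars_iff_distr_eq_PiM) (simp_all add: col)
  also have "\<dots> = density ?L (\<lambda>\<phi>. \<Prod>j\<in>UNIV. ?f (\<phi> j))"
    unfolding distr by (rule density_PiM_prod) (fact)+
  finally have law: "distr M (PiM UNIV (\<lambda>_. borel)) (\<lambda>\<omega> j. column j (X \<omega>)) = density ?L (\<lambda>\<phi>. \<Prod>j\<in>UNIV. ?f (\<phi> j))"
    by (simp only: restrict_UNIV)
  define h where "h = (\<lambda>Z :: complex^'m^'n. (\<Prod>j\<in>UNIV. ?f (column j Z)) * g Z)"
  have [measurable]: "(\<lambda>Z :: complex^'m^'n. column j Z) \<in> borel_measurable borel" for j
    unfolding column_def by measurable
  have [measurable]: "h \<in> borel_measurable borel" unfolding h_def by measurable
  define g' where "g' = (\<lambda>\<phi> :: 'm \<Rightarrow> complex^'n. g (\<chi> i j. \<phi> j $ i))"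
  have g'[measurable]: "g' \<in> borel_measurable (PiM UNIV (\<lambda>_. borel))"
    unfolding g'_def by measurable
  have "(\<integral>\<^sup>+\<omega>. g (X \<omega>) \<partial>M) = (\<integral>\<^sup>+\<omega>. g' (\<lambda>j. column j (X \<omega>)) \<partial>M)"
    by (simp add: g'_def columns_vec_lambda)
  also have "\<dots> = (\<integral>\<^sup>+\<phi>. g' \<phi> \<partial>distr M (PiM UNIV (\<lambda>_. borel)) (\<lambda>\<omega> j. column j (X \<omega>)))"
  proof (rule nn_integral_distr[symmetric])
    have "(\<lambda>\<omega>. \<lambda>j\<in>UNIV. column j (X \<omega>)) \<in> M \<rightarrow>\<^sub>M PiM UNIV (\<lambda>_. borel)"
      by (rule measurable_restrict) measurable
    then show "(\<lambda>\<omega> j. column j (X \<omega>)) \<in> M \<rightarrow>\<^sub>M PiM UNIV (\<lambda>_. borel)" by (simp only: restrict_UNIV)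
  qed measurable
  also have "\<dots> = (\<integral>\<^sup>+\<phi>. (\<Prod>j\<in>UNIV. ?f (\<phi> j)) * g' \<phi> \<partial>?L)"
    unfolding law
  proof (rule nn_integral_density)
    show "g' \<in> borel_measurable ?L"
      unfolding g'_def by measurable
  qed measurable
  also have "\<dots> = (\<integral>\<^sup>+\<phi>. h (\<chi> i j. \<phi> j $ i) \<partial>?L)"
    by (simp add: g'_def h_def column_def)
  also have "\<dots> = (\<integral>\<^sup>+Z. h Z \<partial>distr ?L borel (\<lambda>\<phi>. \<chi> i j. \<phi> j $ i))"
    by (rule nn_integral_distr[symmetric]) measurable
  finally show ?thesis by (simp only: lborel_vec_columns h_def)
qed

section \<open>Positive definite matrices and their eigenvalues\<close>

lemma positive_definite_det:
  assumes "positive_definite R"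
  shows "det R = complex_of_real (Re (det R))" "0 < Re (det R)"
proof -
  obtain B where B: "R = cadjoint B ** B" "scales_volume TYPE(1) B"
    using positive_definite_factorization[OF assms] by blast
  have "det R = complex_of_real ((cmod (det B))\<^sup>2)"
    unfolding B(1) det_mul det_cadjoint complex_norm_square by (rule mult.commute)
  then show "det R = complex_of_real (Re (det R))" "0 < Re (det R)"
    using B(2) by (simp_all add: scales_volume_def)
qed

lemma matrix_inv_mult:
  assumes "positive_definite R"
  shows "R ** matrix_inv R = mat 1" "matrix_inv R ** R = mat 1"
proof -
  have "det R \<noteq> 0" using positive_definite_det[OF assms] by auto
  then have "invertible R" by (simp add: invertible_det_nz)
  then have "\<exists>S. R ** S = mat 1 \<and> S ** R = mat 1" by (simp add: invertible_def)
  from someI_ex[OF this] show "R ** matrix_inv R = mat 1" "matrix_inv R ** R = mat 1"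
    unfolding matrix_inv_def by auto
qed

lemma positive_definite_matrix_inv:
  assumes "positive_definite R"
  shows "positive_definite (matrix_inv R)"
  unfolding positive_definite_def
proof (intro conjI allI impI)
  let ?S = "matrix_inv R"
  note inv = matrix_inv_mult[OF assms]
  have R: "cadjoint R = R" using assms by (simp add: positive_definite_def)
  have "cadjoint ?S ** R = mat 1"
    using inv(1) by (metis cadjoint_mult R cadjoint_mat_1)
  then have "cadjoint ?S ** R ** ?S = ?S" by simp
  moreover have "cadjoint ?S ** R ** ?S = cadjoint ?S"
    using inv(1) by (simp flip: matrix_mul_assoc)
  ultimately show S: "cadjoint ?S = ?S" by simp
  fix z :: "complex^'a" assume "z \<noteq> 0"
  have "R *v (?S *v z) = z" by (simp add: matrix_vector_mul_assoc inv)
  with \<open>z \<noteq> 0\<close> have "?S *v z \<noteq> 0" by auto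
  then have "0 < Re (herm_form R (?S *v z))" using assms by (simp add: positive_definite_def)
  also have "herm_form R (?S *v z) = herm_form ?S z"
    using herm_form_congruence[of ?S R z] \<open>cadjoint ?S ** R ** ?S = ?S\<close> by simp
  finally show "0 < Re (herm_form ?S z)" .
qed

lemma herm_form_diff_mat: "herm_form (A - mat c) z = herm_form A z - c * complex_of_real ((norm z)\<^sup>2)"
proof -
  have "herm_form (mat c) z = c * herm_form (mat 1) z"
    by (simp add: herm_form_eq_sum mat_def if_distrib[of "\<lambda>c. _ * c"] if_distrib[of "\<lambda>c. c * _"]
        sum_distrib_left mult_ac cong: if_cong)
  then show ?thesis
    unfolding herm_form_mat_1[symmetric]
    by (simp add: herm_form_eq_sum algebra_simps sum_subtractf)
qed

lemma herm_form_eigenvector: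
  assumes "A *v z = c *s z"
  shows "herm_form A z = c * complex_of_real ((norm z)\<^sup>2)"
  unfolding herm_form_mat_1[symmetric] using assms
  by (simp add: herm_form_def sum_distrib_left mult_ac)

text \<open>The form of \<open>S\<close> is the squared norm of \<open>B *v z\<close> for an injective \<open>B\<close>, hence bounded below by a multiple of the squared
norm of \<open>z\<close>.\<close>
lemma positive_definite_diff_small:
  fixes S :: "complex^'n^'n"
  assumes S: "positive_definite S"
  obtains \<delta> where "0 < \<delta>" "\<And>\<tau>. \<tau> < \<delta> \<Longrightarrow> positive_definite (S - mat (complex_of_real \<tau>))"
proof -
  obtain B where B: "S = cadjoint B ** B" "scales_volume TYPE(1) B"
    using positive_definite_factorization[OF S] by blast
  have form: "herm_form S z = complex_of_real ((norm (B *v z))\<^sup>2)" for z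
    using herm_form_congruence[of B "mat 1" z] B(1) by (simp add: herm_form_mat_1)
  have "linear ((*v) B)"
    by (rule linearI) (simp_all add: matrix_vector_right_distrib scaleR_conv_vector_scale vec.scale vector_scalar_commute)
  moreover have "inj ((*v) B)"
    using B(2) by (simp add: scales_volume_def inj_matrix_vector_mult invertible_det_nz)
  ultimately obtain c where c: "0 < c" "\<And>z. c * norm z \<le> norm (B *v z)"
    using linear_inj_bounded_below_pos by blast
  show thesis
  proof
    show "0 < c\<^sup>2" using c by simp
    fix \<tau> assume \<tau>: "\<tau> < c\<^sup>2"
    show "positive_definite (S - mat (complex_of_real \<tau>))"
      unfolding positive_definite_def
    proof (intro conjI allI impI)
      have "cadjoint (mat (complex_of_real \<tau>)) = (mat (complex_of_real \<tau>) :: complex^'n^'n)"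
        by (simp add: cadjoint_def mat_def vec_eq_iff)
      moreover have "cadjoint (S - mat (complex_of_real \<tau>)) = cadjoint S - cadjoint (mat (complex_of_real \<tau>))"
        by (simp add: cadjoint_def vec_eq_iff)
      ultimately show "cadjoint (S - mat (complex_of_real \<tau>)) = S - mat (complex_of_real \<tau>)"
        using S by (simp add: positive_definite_def)
      fix z :: "complex^'n" assume "z \<noteq> 0"
      then have "\<tau> * (norm z)\<^sup>2 < c\<^sup>2 * (norm z)\<^sup>2"
        using \<tau> by simp
      also have "\<dots> \<le> (norm (B *v z))\<^sup>2"
        using c(2)[of z] c(1) by (simp flip: power_mult_distrib add: power_mono)
      finally show "0 < Re (herm_form (S - mat (complex_of_real \<tau>)) z)"
        by (simp add: herm_form_diff_mat form del: of_real_power flip: of_real_mult of_real_diff)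
    qed
  qed
qed

lemma ordered_eigenvalues_eigenvector:
  fixes A :: "complex^'n^'n"
  assumes "ordered_eigenvalues A y" "i \<in> {1..CARD('n)}"
  obtains z where "z \<noteq> 0" "A *v z = complex_of_real (y i) *s z"
proof -
  let ?B = "mat (complex_of_real (y i)) - A"
  have "det ?B = (\<Prod>j = 1..CARD('n). complex_of_real (y i) - complex_of_real (y j))"
    using assms(1) by (simp add: ordered_eigenvalues_def)
  also have "\<dots> = 0" using assms(2) by (intro prod_zero) auto
  finally have "\<not> invertible ?B" by (simp add: invertible_det_nz)
  then have "\<not> (\<exists>C. C ** ?B = mat 1)" by (simp add: invertible_left_inverse)
  then obtain z where z: "z \<noteq> 0" "?B *v z = 0" by (auto simp: matrix_left_invertible_ker)
  have "mat (complex_of_real (y i)) *v z = complex_of_real (y i) *s z"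
    by (simp add: vec_eq_iff matrix_vector_mult_def mat_def if_distrib[of "\<lambda>c. c * _"] cong: if_cong)
  with z have "A *v z = complex_of_real (y i) *s z"
    by (simp add: matrix_vector_mult_diff_rdistrib)
  with z(1) show thesis by (rule that)
qed

lemma eigenvalues_gt_if_shift_positive_definite:
  fixes A :: "complex^'n^'n"
  assumes "ordered_eigenvalues A y" "i \<in> {1..CARD('n)}"
    and "positive_definite (A - mat (complex_of_real c))"
  shows "c < y i"
proof -
  obtain z where z: "z \<noteq> 0" "A *v z = complex_of_real (y i) *s z"
    using ordered_eigenvalues_eigenvector[OF assms(1,2)] .
  have "0 < Re (herm_form (A - mat (complex_of_real c)) z)"
    using assms(3) z(1) by (simp add: positive_definite_def)
  also have "\<dots> = (y i - c) * (norm z)\<^sup>2"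
    unfolding herm_form_diff_mat herm_form_eigenvector[OF z(2)]
    by (simp add: algebra_simps del: of_real_power flip: of_real_mult)
  finally show ?thesis using z(1) by (simp add: zero_less_mult_iff)
qed

lemma det_mat_mult: "det (mat c ** A) = c ^ CARD('n) * det A" for A :: "'a::field^'n^'n"
  by (simp add: det_mul) (simp add: det_diagonal mat_def)

lemma det_eq_prod_eigenvalues:
  fixes R :: "complex^'n^'n"
  assumes "ordered_eigenvalues R y"
  shows "det R = (\<Prod>i = 1..CARD('n). complex_of_real (y i))"
proof -
  have "det (mat (- 1) ** R) = det (mat 0 - R)"
    by (rule arg_cong[where f=det]) (simp add: vec_eq_iff matrix_matrix_mult_def mat_def if_distrib[of "\<lambda>c. c * _"] cong: if_cong)
  also have "\<dots> = (\<Prod>i = 1..CARD('n). 0 - complex_of_real (y i))"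
    using assms unfolding ordered_eigenvalues_def by blast
  also have "\<dots> = (- 1) ^ CARD('n) * (\<Prod>i = 1..CARD('n). complex_of_real (y i))"
    by (simp add: prod_uminus)
  finally show ?thesis by (simp add: det_mat_mult)
qed

text \<open>The characteristic polynomial suffices here: multiplying the matrix by \<open>R\<close> gives \<open>\<tau>\<close> times the
difference of \<open>1 / \<tau>\<close> and \<open>R\<close>, so no diagonalization is required.\<close>
lemma det_inverse_diff:
  fixes R :: "complex^'n^'n"
  assumes R: "positive_definite R" and y: "ordered_eigenvalues R y" and "\<tau> \<noteq> 0"
  shows "det (matrix_inv R - mat (complex_of_real \<tau>)) =
    complex_of_real ((\<Prod>i = 1..CARD('n). 1 - \<tau> * y i) / (\<Prod>i = 1..CARD('n). y i))"
proof -
  let ?t = "complex_of_real \<tau>"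
  have diff: "(A - B) ** C = A ** C - B ** C" for A B C :: "complex^'n^'n"
    by (simp add: vec_eq_iff matrix_matrix_mult_def sum_subtractf algebra_simps)
  have diff': "C ** (A - B) = C ** A - C ** B" for A B C :: "complex^'n^'n"
    by (simp add: vec_eq_iff matrix_matrix_mult_def sum_subtractf algebra_simps)
  have "(matrix_inv R - mat ?t) ** R = mat ?t ** (mat (1 / ?t) - R)"
  proof -
    have "mat ?t ** mat (1 / ?t) = (mat 1 :: complex^'n^'n)"
      using \<open>\<tau> \<noteq> 0\<close> by (simp add: vec_eq_iff matrix_matrix_mult_def mat_def if_distrib[of "\<lambda>c. c * _"] cong: if_cong)
    then show ?thesis by (simp add: diff diff' matrix_inv_mult[OF R])
  qed
  then have "det (matrix_inv R - mat ?t) * det R = ?t ^ CARD('n) * det (mat (1 / ?t) - R)"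
    by (metis det_mul det_mat_mult)
  also have "\<dots> = (\<Prod>i = 1..CARD('n). ?t * (1 / ?t - complex_of_real (y i)))"
    using y by (simp add: ordered_eigenvalues_def prod.distrib)
  also have "\<dots> = complex_of_real (\<Prod>i = 1..CARD('n). 1 - \<tau> * y i)"
    using \<open>\<tau> \<noteq> 0\<close> by (simp add: right_diff_distrib)
  finally have "det (matrix_inv R - mat ?t) * det R = complex_of_real (\<Prod>i = 1..CARD('n). 1 - \<tau> * y i)" .
  moreover have "det R = complex_of_real (\<Prod>i = 1..CARD('n). y i)"
    using det_eq_prod_eigenvalues[OF y] by simp
  moreover have "det R \<noteq> 0" using positive_definite_det[OF R] by auto
  ultimately show ?thesis by (simp add: field_simps)
qed

section \<open>The tilted moment generating function\<close>

lemma prod_complex_normal_density: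
  fixes Z :: "complex^'m^'n"
  assumes "positive_definite R"
  shows "(\<Prod>j\<in>UNIV. ennreal (complex_normal_density R (column j Z))) =
    ennreal (exp (- (\<Sum>j\<in>UNIV. Re (herm_form (matrix_inv R) (column j Z)))) / (pi ^ CARD('n) * Re (det R)) ^ CARD('m))"
proof -
  have "0 \<le> complex_normal_density R z" for z
    using positive_definite_det(2)[OF assms] by (simp add: complex_normal_density_def)
  then show ?thesis
    by (simp add: prod_ennreal) (simp add: complex_normal_density_def prod_dividef exp_sum sum_negf[symmetric])
qed

text \<open>The squared norm of \<open>X\<close> is the trace of \<open>X ** cadjoint X\<close>. Multiplying the Gaussian density by its exponential
replaces the inverse covariance by \<open>matrix_inv R - mat \<tau>\<close>, so that the integral is of the kind already
computed. As a function of \<open>\<tau>\<close>, the result is a constant times the moment generating function of a sum of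
independent Gamma variables with scales \<open>y i\<close> and common parameter \<open>CARD('m) - s\<close>.\<close>
theorem complex_normal_moment_generating:
  fixes X :: "'a \<Rightarrow> complex^'m^'n" and s :: real
  assumes M: "prob_space M" and X: "complex_normal_matrix M X R" and y: "ordered_eigenvalues R y"
    and s: "0 < s" "s + real (CARD('n)) < real (CARD('m)) + 1"
    and \<tau>: "\<tau> \<noteq> 0" "positive_definite (matrix_inv R - mat (complex_of_real \<tau>))"
  shows "(\<integral>\<^sup>+\<omega>. ennreal (exp (\<tau> * (norm (X \<omega>))\<^sup>2) * Re (det (X \<omega> ** cadjoint (X \<omega>))) powr - s) \<partial>M) =
    ennreal ((\<Prod>i = 1..CARD('n). y i) powr - s * (\<Prod>i = 1..CARD('n). 1 - \<tau> * y i) powr (s - real (CARD('m))) *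
      (\<Prod>l<CARD('n). Gamma (real (CARD('m)) - real l - s) / Gamma (real (CARD('m)) - real l)))"
proof -
  let ?m = "real (CARD('m))"
  let ?D = "\<lambda>Z :: complex^'m^'n. Re (det (Z ** cadjoint Z))"
  let ?A = "matrix_inv R - mat (complex_of_real \<tau>)"
  let ?C = "\<Prod>l<CARD('n). Gamma (?m - real l - s) / Gamma (?m - real l)"
  let ?q = "\<lambda>A (Z :: complex^'m^'n). \<Sum>j\<in>UNIV. Re (herm_form A (column j Z))"
  define Y where "Y = (\<Prod>i = 1..CARD('n). y i)"
  define P where "P = (\<Prod>i = 1..CARD('n). 1 - \<tau> * y i)"
  have R: "positive_definite R" using X by (simp add: complex_normal_matrix_def)
  have det_R: "Re (det R) = Y"
    using det_eq_prod_eigenvalues[OF y] by (simp add: Y_def flip: of_real_prod)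
  then have Y: "0 < Y" using positive_definite_det(2)[OF R] by simp
  have det_A: "Re (det ?A) = P / Y"
    unfolding det_inverse_diff[OF R y \<tau>(1)] Re_complex_of_real P_def Y_def ..
  then have P: "0 < P" using positive_definite_det(2)[OF \<tau>(2)] Y by (simp add: zero_less_divide_iff)
  define K where "K = (pi ^ CARD('n) * Y) ^ CARD('m)"
  have K: "0 < K" using Y by (simp add: K_def)
  have "(\<integral>\<^sup>+\<omega>. ennreal (exp (\<tau> * (norm (X \<omega>))\<^sup>2) * ?D (X \<omega>) powr - s) \<partial>M) =
      (\<integral>\<^sup>+Z. (\<Prod>j\<in>UNIV. ennreal (complex_normal_density R (column j Z))) *
        ennreal (exp (\<tau> * (norm Z)\<^sup>2) * ?D Z powr - s) \<partial>lborel)"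
    by (rule nn_integral_complex_normal_matrix[OF M X]) measurable
  also have "\<dots> = (\<integral>\<^sup>+Z. ennreal (1 / K) * ennreal (exp (- ?q ?A Z) * ?D Z powr - s) \<partial>lborel)"
  proof (rule nn_integral_cong)
    fix Z :: "complex^'m^'n"
    have "?q ?A Z = ?q (matrix_inv R) Z - \<tau> * (norm Z)\<^sup>2"
      unfolding norm_square_columns
      by (simp add: herm_form_diff_mat sum_subtractf sum_distrib_left del: of_real_power flip: of_real_mult)
    then have "exp (- ?q (matrix_inv R) Z) / K * (exp (\<tau> * (norm Z)\<^sup>2) * ?D Z powr - s) =
        1 / K * (exp (- ?q ?A Z) * ?D Z powr - s)"
      by (simp add: mult_exp_exp)
    then show "(\<Prod>j\<in>UNIV. ennreal (complex_normal_density R (column j Z))) *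
        ennreal (exp (\<tau> * (norm Z)\<^sup>2) * ?D Z powr - s) =
        ennreal (1 / K) * ennreal (exp (- ?q ?A Z) * ?D Z powr - s)"
      unfolding prod_complex_normal_density[OF R] det_R K_def[symmetric]
      using K by (simp flip: ennreal_mult' add: mult.assoc)
  qed
  also have "\<dots> = ennreal (1 / K) * (\<integral>\<^sup>+Z. ennreal (exp (- ?q ?A Z) * ?D Z powr - s) \<partial>lborel)"
  proof (rule nn_integral_cmult)
    have "(\<lambda>Z. ennreal (exp (- ?q ?A Z) * ?D Z powr - s)) \<in> borel_measurable borel" by measurable
    then show "(\<lambda>Z. ennreal (exp (- ?q ?A Z) * ?D Z powr - s)) \<in> borel_measurable lborel" by simp
  qed
  also have "\<dots> = ennreal (1 / K) * ennreal ((P / Y) powr (s - ?m) *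
      (\<Prod>l<CARD('n). pi ^ CARD('m) * Gamma (?m - real l - s) / Gamma (?m - real l)))"
    unfolding nn_integral_det_powr_gaussian[OF \<tau>(2) s] det_A ..
  also have "\<dots> = ennreal (1 / K * ((P / Y) powr (s - ?m) * ((pi ^ CARD('m)) ^ CARD('n) * ?C)))"
  proof -
    have "(\<Prod>l<CARD('n). pi ^ CARD('m) * Gamma (?m - real l - s) / Gamma (?m - real l)) =
        (pi ^ CARD('m)) ^ CARD('n) * ?C"
      unfolding times_divide_eq_right[symmetric] prod.distrib by simp
    then show ?thesis using K by (simp flip: ennreal_mult')
  qed
  also have "1 / K * ((P / Y) powr (s - ?m) * ((pi ^ CARD('m)) ^ CARD('n) * ?C)) =
      Y powr - s * P powr (s - ?m) * ?C"
  proof -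
    have "(P / Y) powr (s - ?m) = P powr (s - ?m) * (Y powr - s * Y ^ CARD('m))"
      using P Y by (simp add: powr_divide powr_diff powr_minus powr_realpow field_simps)
    moreover have "K = (pi ^ CARD('m)) ^ CARD('n) * Y ^ CARD('m)"
      by (simp add: K_def power_mult_distrib mult.commute flip: power_mult)
    ultimately show ?thesis using Y by simp
  qed
  finally show ?thesis by (simp add: Y_def P_def)
qed

section \<open>Moments and power series coefficients\<close>

text \<open>Agreement to the right of 0 is enough: after division by a power of \<open>t\<close>, the first nonzero coefficient of the
difference would be the limit at 0 of a function that vanishes for small positive \<open>t\<close>.\<close>
lemma powser_coeffs_unique:
  fixes a b :: "nat \<Rightarrow> real"
  assumes \<delta>: "0 < \<delta>"
    and a: "\<And>t. 0 < t \<Longrightarrow> t < \<delta> \<Longrightarrow> (\<lambda>k. a k * t ^ k) sums f t"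
    and b: "\<And>t. 0 < t \<Longrightarrow> t < \<delta> \<Longrightarrow> (\<lambda>k. b k * t ^ k) sums f t"
  shows "a k = b k"
proof (induction k rule: less_induct)
  case (less k)
  define d where "d = (\<lambda>j. a (j + k) - b (j + k))"
  have d: "(\<lambda>j. d j * t ^ j) sums 0" if t: "0 < t" "t < \<delta>" for t
  proof -
    have "(\<lambda>j. (a j - b j) * t ^ j) sums 0"
      using sums_diff[OF a[OF t] b[OF t]] by (simp add: left_diff_distrib)
    then have "(\<lambda>j. (a (j + k) - b (j + k)) * t ^ (j + k)) sums (0 - (\<Sum>i<k. (a i - b i) * t ^ i))"
      by (rule sums_split_initial_segment)
    then have "(\<lambda>j. t ^ k * (d j * t ^ j)) sums 0"
      using less by (simp add: d_def power_add mult_ac)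
    from sums_mult[OF this, of "inverse (t ^ k)"] show ?thesis
      using t by (simp flip: mult.assoc)
  qed
  have "summable (\<lambda>j. d j * (\<delta> / 2) ^ j)"
    using d[of "\<delta> / 2"] \<delta> by (auto intro: sums_summable)
  then have "isCont (\<lambda>x. \<Sum>j. d j * x ^ j) 0"
    using \<delta> by (intro isCont_powser) auto
  then have "((\<lambda>x. \<Sum>j. d j * x ^ j) \<longlongrightarrow> (\<Sum>j. d j * 0 ^ j)) (at_right 0)"
    unfolding isCont_def by (rule filterlim_mono) (auto simp: at_le)
  moreover have "((\<lambda>x. \<Sum>j. d j * x ^ j) \<longlongrightarrow> 0) (at_right 0)"
  proof (rule tendsto_eventually)
    show "\<forall>\<^sub>F x in at_right 0. (\<Sum>j. d j * x ^ j) = 0"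
      using eventually_at_right_real[OF \<delta>]
      by eventually_elim (use d in \<open>auto simp: sums_iff\<close>)
  qed
  ultimately have "(\<Sum>j. d j * 0 ^ j) = 0"
    by (rule tendsto_unique[OF trivial_limit_at_right_real])
  then show ?case by (simp add: d_def)
qed

lemma sums_negative_binomial:
  fixes c t y :: real
  assumes "0 < c" "\<bar>t * y\<bar> < 1"
  shows "(\<lambda>k. Gamma (c + real k) * y ^ k / (Gamma (real k + 1) * Gamma c) * t ^ k) sums ((1 - t * y) powr - c)"
proof -
  have "(- c gchoose k) * (- (t * y)) ^ k = Gamma (c + real k) * y ^ k / (Gamma (real k + 1) * Gamma c) * t ^ k" for k
  proof -
    have "(- c gchoose k) * (- (t * y)) ^ k = ((- 1) ^ k * (- 1) ^ k) * (pochhammer c k / fact k * (t * y) ^ k)"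
      by (simp add: gbinomial_pochhammer power_minus[of "t * y"])
    also have "(- 1) ^ k * (- 1) ^ k = (1 :: real)"
      by (simp flip: power_mult_distrib)
    also have "pochhammer c k = Gamma (c + real k) / Gamma c"
      using assms by (intro pochhammer_Gamma) (auto elim!: nonpos_Ints_cases)
    finally show ?thesis
      using Gamma_fact[of k, where 'a=real] by (simp add: power_mult_distrib add.commute mult_ac)
  qed
  then show ?thesis
    using gen_binomial_real[of "- (t * y)" "- c"] assms by simp
qed

definition weak_compositions :: "'i set \<Rightarrow> nat \<Rightarrow> ('i \<Rightarrow> nat) set"
  where "weak_compositions I p = {\<kappa> \<in> I \<rightarrow>\<^sub>E UNIV. (\<Sum>i\<in>I. \<kappa> i) = p}"

lemma finite_weak_compositions:
  assumes "finite I"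
  shows "finite (weak_compositions I p)"
proof (rule finite_subset)
  show "weak_compositions I p \<subseteq> I \<rightarrow>\<^sub>E {..p}"
  proof
    fix \<kappa> assume \<kappa>: "\<kappa> \<in> weak_compositions I p"
    then have "\<kappa> i \<le> p" if "i \<in> I" for i
      using that assms member_le_sum[of i I \<kappa>] by (auto simp: weak_compositions_def)
    with \<kappa> show "\<kappa> \<in> I \<rightarrow>\<^sub>E {..p}" by (auto simp: weak_compositions_def PiE_def Pi_def)
  qed
qed (use assms in \<open>auto intro: finite_PiE\<close>)

lemma sum_weak_compositions_insert:
  fixes c :: "'i \<Rightarrow> nat \<Rightarrow> 'a::comm_semiring_1"
  assumes "finite I" "a \<notin> I"
  shows "(\<Sum>\<kappa>\<in>weak_compositions (insert a I) p. \<Prod>i\<in>insert a I. c i (\<kappa> i)) =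
    (\<Sum>k\<le>p. c a k * (\<Sum>\<kappa>\<in>weak_compositions I (p - k). \<Prod>i\<in>I. c i (\<kappa> i)))"
proof -
  have "(\<Sum>k\<le>p. c a k * (\<Sum>\<kappa>\<in>weak_compositions I (p - k). \<Prod>i\<in>I. c i (\<kappa> i))) =
      (\<Sum>(k, \<kappa>)\<in>(SIGMA k:{..p}. weak_compositions I (p - k)). c a k * (\<Prod>i\<in>I. c i (\<kappa> i)))"
    using assms by (simp add: sum_distrib_left sum.Sigma finite_weak_compositions)
  also have "\<dots> = (\<Sum>\<kappa>\<in>weak_compositions (insert a I) p. \<Prod>i\<in>insert a I. c i (\<kappa> i))"
  proof (rule sum.reindex_bij_witness[where j="\<lambda>(k, \<kappa>). \<kappa>(a := k)" and i="\<lambda>\<kappa>. (\<kappa> a, \<kappa>(a := undefined))"])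
    have upd: "(\<Sum>i\<in>I. (\<kappa>(a := k)) i) = (\<Sum>i\<in>I. \<kappa> i)" for \<kappa> :: "'i \<Rightarrow> nat" and k
      using assms by (intro sum.cong) auto
    fix x assume x: "x \<in> (SIGMA k:{..p}. weak_compositions I (p - k))"
    then obtain k \<kappa> where k: "x = (k, \<kappa>)" "k \<le> p" "\<kappa> \<in> weak_compositions I (p - k)" by auto
    then have "\<kappa> a = undefined" using assms by (auto simp: weak_compositions_def PiE_def extensional_def)
    then show "(\<lambda>\<kappa>. (\<kappa> a, \<kappa>(a := undefined))) ((\<lambda>(k, \<kappa>). \<kappa>(a := k)) x) = x"
      using k by (auto simp: fun_eq_iff)
    show "(\<lambda>(k, \<kappa>). \<kappa>(a := k)) x \<in> weak_compositions (insert a I) p"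
      using k assms upd[of \<kappa> k] by (auto simp: weak_compositions_def PiE_def extensional_def)
    have "(\<Prod>i\<in>I. c i ((\<kappa>(a := k)) i)) = (\<Prod>i\<in>I. c i (\<kappa> i))"
      using assms by (intro prod.cong) auto
    then show "(\<Prod>i\<in>insert a I. c i (((\<lambda>(k, \<kappa>). \<kappa>(a := k)) x) i)) = (case x of (k, \<kappa>) \<Rightarrow> c a k * (\<Prod>i\<in>I. c i (\<kappa> i)))"
      using assms k by simp
  next
    have upd: "(\<Sum>i\<in>I. (\<kappa>(a := k)) i) = (\<Sum>i\<in>I. \<kappa> i)" for \<kappa> :: "'i \<Rightarrow> nat" and k
      using assms by (intro sum.cong) auto
    fix \<kappa> assume \<kappa>: "\<kappa> \<in> weak_compositions (insert a I) p"
    show "(\<lambda>(k, \<kappa>). \<kappa>(a := k)) (\<kappa> a, \<kappa>(a := undefined)) = \<kappa>" by simp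
    show "(\<kappa> a, \<kappa>(a := undefined)) \<in> (SIGMA k:{..p}. weak_compositions I (p - k))"
      using \<kappa> assms upd[of \<kappa> undefined] by (auto simp: weak_compositions_def PiE_def extensional_def)
  qed
  finally show ?thesis by (rule sym)
qed

text \<open>Iterated Cauchy products. The coefficients are assumed nonnegative so that convergence is absolute.\<close>
lemma sums_prod_weak_compositions:
  fixes c :: "'i \<Rightarrow> nat \<Rightarrow> real" and t :: real
  assumes "finite I" "0 \<le> t" "\<And>i k. i \<in> I \<Longrightarrow> 0 \<le> c i k"
    and "\<And>i. i \<in> I \<Longrightarrow> (\<lambda>k. c i k * t ^ k) sums f i"
  shows "(\<lambda>p. (\<Sum>\<kappa>\<in>weak_compositions I p. \<Prod>i\<in>I. c i (\<kappa> i)) * t ^ p) sums (\<Prod>i\<in>I. f i)"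
  using assms
proof (induction I rule: finite_induct)
  case empty
  have "weak_compositions ({} :: 'i set) p = (if p = 0 then {\<lambda>_. undefined} else {})" for p
    by (auto simp: weak_compositions_def)
  then have "(\<lambda>p. (\<Sum>\<kappa>\<in>weak_compositions ({} :: 'i set) p. \<Prod>i\<in>{}. c i (\<kappa> i)) * t ^ p) =
      (\<lambda>p. if p = 0 then 1 else 0)"
    by auto
  then show ?case using sums_single[of 0 "\<lambda>_. 1 :: real"] by simp
next
  case (insert a I)
  define S where "S = (\<lambda>p. \<Sum>\<kappa>\<in>weak_compositions I p. \<Prod>i\<in>I. c i (\<kappa> i))"
  have S: "(\<lambda>p. S p * t ^ p) sums (\<Prod>i\<in>I. f i)"
    using insert by (auto simp: S_def)
  have a: "(\<lambda>k. c a k * t ^ k) sums f a"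
    using insert by auto
  have S_nonneg: "0 \<le> S p" for p
    using insert.prems unfolding S_def by (intro sum_nonneg prod_nonneg) auto
  have "(\<lambda>p. \<Sum>k\<le>p. c a k * t ^ k * (S (p - k) * t ^ (p - k))) sums
      ((\<Sum>k. c a k * t ^ k) * (\<Sum>p. S p * t ^ p))"
    using S a insert.prems S_nonneg
    by (intro Cauchy_product_sums) (auto simp: abs_mult sums_iff)
  also have "(\<lambda>p. \<Sum>k\<le>p. c a k * t ^ k * (S (p - k) * t ^ (p - k))) =
      (\<lambda>p. (\<Sum>k\<le>p. c a k * S (p - k)) * t ^ p)"
  proof
    fix p
    have "c a k * t ^ k * (S (p - k) * t ^ (p - k)) = c a k * S (p - k) * t ^ p" if "k \<in> {..p}" for k
    proof -
      have "t ^ p = t ^ k * t ^ (p - k)" using that by (simp flip: power_add)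
      then show ?thesis by (simp add: mult_ac)
    qed
    then show "(\<Sum>k\<le>p. c a k * t ^ k * (S (p - k) * t ^ (p - k))) = (\<Sum>k\<le>p. c a k * S (p - k)) * t ^ p"
      unfolding sum_distrib_right by (rule sum.cong[OF refl])
  qed
  also have "(\<Sum>k. c a k * t ^ k) * (\<Sum>p. S p * t ^ p) = (\<Prod>i\<in>insert a I. f i)"
    using S a insert.hyps by (simp add: sums_iff)
  finally show ?case
    by (simp only: sum_weak_compositions_insert[OF insert.hyps] S_def)
qed

lemma ennreal_exp_suminf:
  fixes x :: real
  assumes "0 \<le> x"
  shows "ennreal (exp x) = (\<Sum>k. ennreal (x ^ k / fact k))"
proof -
  have "(\<lambda>k. x ^ k / fact k) sums exp x"
    using exp_converges[of x] by (simp add: field_simps)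
  then have "(\<lambda>k. ennreal (x ^ k / fact k)) sums ennreal (exp x)"
    using assms by (subst sums_ennreal) auto
  then show ?thesis by (simp add: sums_iff)
qed

text \<open>All terms of the exponential series are nonnegative, so summation and integration may be exchanged without any
prior knowledge of the moments; their finiteness is a consequence of the finite generating function.\<close>
lemma nn_integral_moment_eq_coeff:
  fixes T w :: "'a \<Rightarrow> real" and a :: "nat \<Rightarrow> real"
  assumes [measurable]: "T \<in> borel_measurable M" "w \<in> borel_measurable M"
    and nonneg: "\<And>\<omega>. 0 \<le> T \<omega>" "\<And>\<omega>. 0 \<le> w \<omega>" and \<delta>: "0 < \<delta>"
    and F: "\<And>t. 0 < t \<Longrightarrow> t < \<delta> \<Longrightarrow> (\<integral>\<^sup>+\<omega>. ennreal (exp (t * T \<omega>) * w \<omega>) \<partial>M) = ennreal (F t)"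
      "\<And>t. 0 < t \<Longrightarrow> t < \<delta> \<Longrightarrow> 0 \<le> F t"
    and a: "\<And>t. 0 < t \<Longrightarrow> t < \<delta> \<Longrightarrow> (\<lambda>k. a k * t ^ k) sums F t"
  shows "(\<integral>\<^sup>+\<omega>. ennreal (T \<omega> ^ k * w \<omega>) \<partial>M) = ennreal (fact k * a k)" and "0 \<le> a k"
proof -
  define \<mu> where "\<mu> = (\<lambda>k. \<integral>\<^sup>+\<omega>. ennreal (T \<omega> ^ k * w \<omega>) \<partial>M)"
  have series: "(\<Sum>k. ennreal (t ^ k / fact k) * \<mu> k) = ennreal (F t)" if t: "0 < t" "t < \<delta>" for t
  proof -
    have "ennreal (F t) = (\<integral>\<^sup>+\<omega>. (\<Sum>k. ennreal (t ^ k / fact k) * ennreal (T \<omega> ^ k * w \<omega>)) \<partial>M)"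
      unfolding F(1)[OF t, symmetric]
    proof (rule nn_integral_cong)
      fix \<omega>
      have "ennreal (exp (t * T \<omega>) * w \<omega>) = (\<Sum>k. ennreal ((t * T \<omega>) ^ k / fact k)) * ennreal (w \<omega>)"
        using t nonneg by (subst ennreal_exp_suminf[symmetric]) (simp_all add: ennreal_mult)
      also have "\<dots> = (\<Sum>k. ennreal ((t * T \<omega>) ^ k / fact k) * ennreal (w \<omega>))"
        by simp
      also have "\<dots> = (\<Sum>k. ennreal (t ^ k / fact k) * ennreal (T \<omega> ^ k * w \<omega>))"
        using t nonneg by (simp add: power_mult_distrib mult_ac flip: ennreal_mult)
      finally show "ennreal (exp (t * T \<omega>) * w \<omega>) = (\<Sum>k. ennreal (t ^ k / fact k) * ennreal (T \<omega> ^ k * w \<omega>))" .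
    qed
    also have "\<dots> = (\<Sum>k. ennreal (t ^ k / fact k) * \<mu> k)"
      unfolding \<mu>_def by (subst nn_integral_suminf) (auto simp: nn_integral_cmult)
    finally show ?thesis by simp
  qed
  have finite: "\<mu> k < \<top>" for k
  proof (rule ccontr)
    assume "\<not> \<mu> k < \<top>"
    then have "\<mu> k = \<top>" using less_top by blast
    then have "ennreal ((\<delta> / 2) ^ k / fact k) * \<mu> k = \<top>"
      using \<delta> by (simp add: ennreal_mult_top)
    moreover have "ennreal ((\<delta> / 2) ^ k / fact k) * \<mu> k \<le> (\<Sum>k. ennreal ((\<delta> / 2) ^ k / fact k) * \<mu> k)"
      using sum_le_suminf[of "\<lambda>k. ennreal ((\<delta> / 2) ^ k / fact k) * \<mu> k" "{k}"] by simp
    ultimately show False using series[of "\<delta> / 2"] \<delta> by (simp add: top_unique)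
  qed
  define r where "r = (\<lambda>k. enn2real (\<mu> k))"
  have r: "\<mu> k = ennreal (r k)" "0 \<le> r k" for k
    using finite[of k] by (simp_all add: r_def)
  have "(\<lambda>k. r k / fact k * t ^ k) sums F t" if t: "0 < t" "t < \<delta>" for t
  proof -
    have "(\<lambda>k. ennreal (r k / fact k * t ^ k)) sums ennreal (F t)"
    proof -
      have "(\<lambda>k. ennreal (t ^ k / fact k) * \<mu> k) sums ennreal (F t)"
        using series[OF t] summable_sums[OF summableI] by metis
      moreover have "ennreal (t ^ k / fact k) * \<mu> k = ennreal (r k / fact k * t ^ k)" for k
        using t r by (simp add: mult_ac flip: ennreal_mult)
      ultimately show ?thesis by simp
    qed
    then show ?thesis
      using t r F(2)[OF t] by (subst (asm) sums_ennreal) auto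
  qed
  from powser_coeffs_unique[OF \<delta> this a, of k] have a_k: "r k / fact k = a k" by simp
  then have "r k = fact k * a k" by (simp add: field_simps)
  then show "(\<integral>\<^sup>+\<omega>. ennreal (T \<omega> ^ k * w \<omega>) \<partial>M) = ennreal (fact k * a k)" "0 \<le> a k"
    using r[of k] a_k[symmetric] by (simp_all add: \<mu>_def)
qed

section \<open>Moments of the sphericity ratio\<close>

lemma trace_mult_cadjoint: "Re (trace (X ** cadjoint X)) = (norm X)\<^sup>2"
  for X :: "complex^'m^'n"
proof -
  have "trace (X ** cadjoint X) = (\<Sum>i\<in>UNIV. cinner (X $ i) (X $ i))"
    by (simp add: trace_def matrix_matrix_mult_def cadjoint_def cinner_def)
  then show ?thesis
    by (simp add: cinner_self norm_square_rows[of X] del: of_real_power)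
qed

text \<open>For singular \<open>X ** cadjoint X\<close> both sides are 0: on the left by a division by 0, as \<open>p\<close> is positive, and on the
right because 0 has the power 0 for every real exponent.\<close>
lemma sphericity_ratio_power:
  fixes X :: "complex^'m^'n"
  assumes "0 < p"
  shows "sphericity_ratio X ^ p = ((norm X)\<^sup>2) ^ p * Re (det (X ** cadjoint X)) powr - (real p / real (CARD('n))) / real (CARD('n)) ^ p"
proof -
  define D where "D = Re (det (X ** cadjoint X))"
  have "(D powr (1 / real (CARD('n)))) ^ p = D powr (real p / real (CARD('n)))"
  proof (cases "D = 0")
    case False
    then have "0 < D" using Re_det_mult_cadjoint_nonneg[of X] by (simp add: D_def)
    then show ?thesis by (simp add: powr_powr flip: powr_realpow)
  qed (use assms in simp)
  then show ?thesis
    unfolding sphericity_ratio_def trace_mult_cadjoint D_def[symmetric]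
    by (simp add: power_divide powr_minus field_simps)
qed

text \<open>Up to the factor \<open>n ^ p\<close>, the \<open>p\<close>-th power of the ratio is that of the trace, weighted by the determinant to the
power \<open>- p / n\<close>. So its expectation is \<open>fact p\<close> times a coefficient of the tilted generating function with \<open>s = p / n\<close>. The
coefficients are left abstract since there are two ways to expand the product: as a single binomial
series when all eigenvalues coincide, and as a product of binomial series otherwise.\<close>
theorem sphericity_ratio_moment:
  fixes X :: "'a \<Rightarrow> complex^'m^'n" and a :: "nat \<Rightarrow> real"
  defines "n \<equiv> CARD('n)" and "m \<equiv> CARD('m)"
  assumes M: "prob_space M" and X: "complex_normal_matrix M X R" and y: "ordered_eigenvalues R y"
    and p: "0 < p" "int p < int n * (int m - int n + 1)"
    and \<delta>: "0 < \<delta>"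
    and a: "\<And>t. 0 < t \<Longrightarrow> t < \<delta> \<Longrightarrow>
      (\<lambda>k. a k * t ^ k) sums ((\<Prod>i = 1..n. 1 - t * y i) powr - (real m - real p / real n))"
  shows "(\<integral>\<omega>. sphericity_ratio (X \<omega>) ^ p \<partial>M) =
    fact p * a p * (\<Prod>i = 1..n. y i) powr - (real p / real n) / real n ^ p *
    (\<Prod>j = 0..<n. Gamma (real m - real n + 1 - real p / real n + real j) / Gamma (real m - real n + 1 + real j))"
proof -
  have n: "0 < n" by (simp add: n_def)
  define s where "s = real p / real n"
  have "real_of_int (int p) < real_of_int (int n * (int m - int n + 1))"
    using p(2) by (simp only: of_int_less_iff)
  then have s: "0 < s" "s + real n < real m + 1"
    using p(1) n by (simp_all add: s_def field_simps)
  let ?D = "\<lambda>Z :: complex^'m^'n. Re (det (Z ** cadjoint Z))"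
  define C where "C = (\<Prod>l<n. Gamma (real m - real l - s) / Gamma (real m - real l))"
  define Y where "Y = (\<Prod>i = 1..n. y i)"
  \<comment> \<open>In \<open>C\<close> the index counts the rows that are already present, in the statement those still to come.\<close>
  have C_eq: "C = (\<Prod>j = 0..<n. Gamma (real m - real n + 1 - s + real j) / Gamma (real m - real n + 1 + real j))"
  proof -
    have "C = (\<Prod>j<n. Gamma (real m - real (n - Suc j) - s) / Gamma (real m - real (n - Suc j)))"
      unfolding C_def by (rule prod.nat_diff_reindex[symmetric])
    also have "\<dots> = (\<Prod>j<n. Gamma (real m - real n + 1 - s + real j) / Gamma (real m - real n + 1 + real j))"
      by (intro prod.cong refl arg_cong2[where f="(/)"] arg_cong[where f=Gamma]) (auto simp: of_nat_diff)
    finally show ?thesis by (simp add: atLeast0LessThan)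
  qed
  have "0 < C" unfolding C_def
    using s by (intro prod_pos) auto
  have R: "positive_definite R" using X by (simp add: complex_normal_matrix_def)
  obtain \<delta>' where \<delta>': "0 < \<delta>'" "\<And>t. t < \<delta>' \<Longrightarrow> positive_definite (matrix_inv R - mat (complex_of_real t))"
    using positive_definite_diff_small[OF positive_definite_matrix_inv[OF R]] by blast
  have [measurable]: "X \<in> borel_measurable M"
    by (rule complex_normal_matrix_measurable[OF M X])
  define w where "w = (\<lambda>\<omega>. ?D (X \<omega>) powr - s)"
  have w[measurable]: "w \<in> borel_measurable M" unfolding w_def by measurable
  let ?F = "\<lambda>t. Y powr - s * (\<Prod>i = 1..n. 1 - t * y i) powr (s - real m) * C"
  have F: "(\<integral>\<^sup>+\<omega>. ennreal (exp (t * (norm (X \<omega>))\<^sup>2) * w \<omega>) \<partial>M) = ennreal (?F t)"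
      "0 \<le> ?F t" "(\<lambda>k. Y powr - s * C * a k * t ^ k) sums ?F t"
    if t: "0 < t" "t < min \<delta> \<delta>'" for t
  proof -
    show "(\<integral>\<^sup>+\<omega>. ennreal (exp (t * (norm (X \<omega>))\<^sup>2) * w \<omega>) \<partial>M) = ennreal (?F t)"
      using complex_normal_moment_generating[OF M X y, of s t] s t \<delta>'(2)[of t]
      by (simp add: w_def Y_def C_def n_def m_def)
    show "0 \<le> ?F t" using \<open>0 < C\<close> by simp
    have "(\<lambda>k. Y powr - s * C * (a k * t ^ k)) sums (Y powr - s * C * (\<Prod>i = 1..n. 1 - t * y i) powr - (real m - s))"
      using a[of t] t by (intro sums_mult) (simp add: s_def)
    then show "(\<lambda>k. Y powr - s * C * a k * t ^ k) sums ?F t"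
      by (simp add: mult_ac)
  qed
  have moment: "(\<integral>\<^sup>+\<omega>. ennreal (((norm (X \<omega>))\<^sup>2) ^ p * w \<omega>) \<partial>M) = ennreal (fact p * (Y powr - s * C * a p))"
    and "0 \<le> Y powr - s * C * a p"
    using nn_integral_moment_eq_coeff[where T="\<lambda>\<omega>. (norm (X \<omega>))\<^sup>2" and w=w and F="?F" and \<delta>="min \<delta> \<delta>'"
        and a="\<lambda>k. Y powr - s * C * a k" and k=p and M=M] F \<delta> \<delta>'(1)
    by (simp_all add: w_def)
  then have "(\<integral>\<omega>. ((norm (X \<omega>))\<^sup>2) ^ p * w \<omega> \<partial>M) = fact p * (Y powr - s * C * a p)"
    by (subst integral_eq_nn_integral) (auto simp: w_def)
  moreover have "sphericity_ratio (X \<omega>) ^ p = ((norm (X \<omega>))\<^sup>2) ^ p * w \<omega> / real n ^ p" for \<omega>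
    unfolding w_def s_def n_def by (rule sphericity_ratio_power[OF p(1)])
  ultimately show ?thesis
    unfolding C_eq[symmetric, unfolded s_def] Y_def s_def
    by simp
qed

theorem theorem1:
  fixes n m k p :: nat
    and N0 :: real
    and H :: "complex^'k^'n"
    and y :: "nat \<Rightarrow> real"
    and M0 :: "'a measure" and X0 :: "'a \<Rightarrow> complex^'m^'n"
    and M1 :: "'b measure" and X1 :: "'b \<Rightarrow> complex^'m^'n"
  assumes "n = CARD('n)" and "m = CARD('m)" and "k = CARD('k)" and "n \<le> k"
    and "0 < N0"
    and "positive_definite (H ** cadjoint H)"
    and "ordered_eigenvalues (H ** cadjoint H + mat (complex_of_real N0)) y"
    and "prob_space M0"
    and "complex_normal_matrix M0 X0 (mat (complex_of_real N0))"
    and "prob_space M1"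
    and "complex_normal_matrix M1 X1 (H ** cadjoint H + mat (complex_of_real N0))"
    and "0 < p" and "int p < int n * (int m - int n + 1)"
  shows "N0 < y 1 \<and>
    (\<integral>\<omega>. sphericity_ratio (X0 \<omega>) ^ p \<partial>M0) =
      Gamma (real (m * n)) / (real n ^ p * Gamma (real (m * n) - real p)) *
      (\<Prod>j = 0..<n. Gamma (real m - real n + 1 - real p / real n + real j) /
                     Gamma (real m - real n + 1 + real j)) \<and>
    (\<integral>\<omega>. sphericity_ratio (X1 \<omega>) ^ p \<partial>M1) =
      fact p * (\<Prod>i = 1..n. y i powr (- real p / real n)) / real n ^ p *
      (\<Prod>j = 0..<n. Gamma (real m - real n + 1 - real p / real n + real j) /
                     Gamma (real m - real n + 1 + real j)) *
      (\<Sum>\<kappa> \<in> {\<kappa> \<in> {1..n} \<rightarrow>\<^sub>E UNIV. (\<Sum>i = 1..n. \<kappa> i) = p}.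
         \<Prod>i = 1..n. Gamma (real m - real p / real n + real (\<kappa> i)) * y i ^ \<kappa> i /
                      (Gamma (real (\<kappa> i) + 1) * Gamma (real m - real p / real n)))"
proof (intro conjI)
  \<comment> \<open>The parameter \<open>m - p / n\<close> of the Gamma variables in the tilted law is \<open>c\<close> below.\<close>
  have n: "0 < n" and n1: "1 \<in> {1..n}" using assms(1) by (simp_all add: Suc_le_eq)
  let ?R0 = "mat (complex_of_real N0) :: complex^'n^'n"
  let ?R1 = "H ** cadjoint H + mat (complex_of_real N0)"
  let ?C = "\<Prod>j = 0..<n. Gamma (real m - real n + 1 - real p / real n + real j) / Gamma (real m - real n + 1 + real j)"
  define c where "c = real m - real p / real n"
  have c: "0 < c" "real n * c = real (m * n) - real p" "0 < real n * c"
  proof -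
    have "real_of_int (int p) < real_of_int (int n * (int m - int n + 1))"
      using assms(13) by (simp only: of_int_less_iff)
    then have "real p < real n * (real m - (real n - 1))" by (simp add: algebra_simps)
    also have "\<dots> \<le> real n * real m" using n by (intro mult_left_mono) auto
    finally show "0 < c" using n by (simp add: c_def field_simps)
    then show "0 < real n * c" using n by simp
    show "real n * c = real (m * n) - real p" using n by (simp add: c_def field_simps)
  qed
  note moment = sphericity_ratio_moment[where 'n='n and 'm='m, folded assms(1,2)]
  have y_gt: "N0 < y i" if "i \<in> {1..n}" for i
    using eigenvalues_gt_if_shift_positive_definite[OF assms(7), of i N0] that assms(1,6) by simp
  then show "N0 < y 1" using n1 by blast
  have y_pos: "0 < y i" if "i \<in> {1..n}" for i using y_gt[OF that] assms(5) by linarith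

  show "(\<integral>\<omega>. sphericity_ratio (X0 \<omega>) ^ p \<partial>M0) =
      Gamma (real (m * n)) / (real n ^ p * Gamma (real (m * n) - real p)) * ?C"
  proof -
    have eig: "ordered_eigenvalues ?R0 (\<lambda>_. N0)"
    proof -
      have "det (mat x - ?R0) = (x - complex_of_real N0) ^ CARD('n)" for x
      proof -
        have "mat x - ?R0 = mat (x - complex_of_real N0)" by (simp add: mat_def vec_eq_iff)
        then show ?thesis using det_mat_mult[of "x - complex_of_real N0" "mat 1 :: complex^'n^'n"] by (simp add: det_I)
      qed
      then show ?thesis by (simp add: ordered_eigenvalues_def mono_on_def)
    qed
    \<comment> \<open>All eigenvalues equal \<open>N0\<close>, so the product is one binomial power with exponent \<open>- n * c\<close>.\<close>
    define a where "a = (\<lambda>k. Gamma (real n * c + real k) * N0 ^ k / (Gamma (real k + 1) * Gamma (real n * c)))"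
    have "(\<integral>\<omega>. sphericity_ratio (X0 \<omega>) ^ p \<partial>M0) =
        fact p * a p * (\<Prod>i = 1..n. N0) powr - (real p / real n) / real n ^ p * ?C"
    proof (rule moment[OF assms(8,9) eig assms(12,13), where \<delta>="1 / N0"])
      show "0 < 1 / N0" using assms(5) by simp
      fix t assume t: "0 < t" "t < 1 / N0"
      then have tN0: "0 < t * N0" "t * N0 < 1" using assms(5) by (simp_all add: field_simps)
      have "(\<Prod>i = 1..n. 1 - t * N0) powr - c = (1 - t * N0) powr - (real n * c)"
        using tN0 by (simp add: powr_powr flip: powr_realpow)
      then show "(\<lambda>k. a k * t ^ k) sums (\<Prod>i = 1..n. 1 - t * N0) powr - (real m - real p / real n)"
        using sums_negative_binomial[OF c(3), of t N0] tN0 by (simp add: a_def c_def[symmetric])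
    qed
    also have "fact p * a p * (\<Prod>i = 1..n. N0) powr - (real p / real n) =
        Gamma (real (m * n)) / Gamma (real (m * n) - real p)"
    proof -
      have "(\<Prod>i = 1..n. N0) powr - (real p / real n) = N0 powr - real p"
        using assms(5) n by (simp add: powr_powr flip: powr_realpow)
      moreover have "N0 ^ p * N0 powr - real p = 1"
        using assms(5) by (simp add: powr_minus powr_realpow)
      moreover have "fact p * a p = Gamma (real (m * n)) / Gamma (real (m * n) - real p) * N0 ^ p"
        using Gamma_fact[of p, where 'a=real] by (simp add: a_def c(2) add.commute)
      ultimately show ?thesis by (simp add: mult.assoc)
    qed
    finally show ?thesis by (simp add: mult.commute)
  qed

  let ?S = "\<Sum>\<kappa> \<in> {\<kappa> \<in> {1..n} \<rightarrow>\<^sub>E UNIV. (\<Sum>i = 1..n. \<kappa> i) = p}.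
      \<Prod>i = 1..n. Gamma (real m - real p / real n + real (\<kappa> i)) * y i ^ \<kappa> i /
        (Gamma (real (\<kappa> i) + 1) * Gamma (real m - real p / real n))"
  show "(\<integral>\<omega>. sphericity_ratio (X1 \<omega>) ^ p \<partial>M1) =
      fact p * (\<Prod>i = 1..n. y i powr (- real p / real n)) / real n ^ p * ?C * ?S"
  proof -
    \<comment> \<open>Below this bound all \<open>n\<close> binomial series converge.\<close>
    define \<delta> where "\<delta> = Min ((\<lambda>i. 1 / y i) ` {1..n})"
    define b where "b = (\<lambda>i k. Gamma (c + real k) * y i ^ k / (Gamma (real k + 1) * Gamma c))"
    define a where "a = (\<lambda>p. \<Sum>\<kappa>\<in>weak_compositions {1..n} p. \<Prod>i = 1..n. b i (\<kappa> i))"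
    have "(\<integral>\<omega>. sphericity_ratio (X1 \<omega>) ^ p \<partial>M1) =
        fact p * a p * (\<Prod>i = 1..n. y i) powr - (real p / real n) / real n ^ p * ?C"
    proof (rule moment[OF assms(10,11,7,12,13)])
      show "0 < \<delta>" unfolding \<delta>_def using n y_pos by (subst Min_gr_iff) auto
      fix t assume t: "0 < t" "t < \<delta>"
      have ty: "0 < t * y i" "t * y i < 1" if "i \<in> {1..n}" for i
      proof -
        have "\<delta> \<le> 1 / y i" unfolding \<delta>_def using that by (intro Min_le) auto
        with t have "t < 1 / y i" by linarith
        then show "0 < t * y i" "t * y i < 1" using y_pos[OF that] t by (simp_all add: field_simps)
      qed
      have "(\<lambda>p. a p * t ^ p) sums (\<Prod>i = 1..n. (1 - t * y i) powr - c)"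
        unfolding a_def
      proof (rule sums_prod_weak_compositions)
        fix i assume i: "i \<in> {1..n}"
        show "0 \<le> b i k" for k
          unfolding b_def using c(1) y_pos[OF i] by (intro divide_nonneg_pos mult_nonneg_nonneg mult_pos_pos) auto
        show "(\<lambda>k. b i k * t ^ k) sums ((1 - t * y i) powr - c)"
          unfolding b_def using ty[OF i] by (intro sums_negative_binomial c(1)) auto
      qed (use t in auto)
      also have "(\<Prod>i = 1..n. (1 - t * y i) powr - c) = (\<Prod>i = 1..n. 1 - t * y i) powr - c"
        by (rule prod_powr_distrib[symmetric])
      finally show "(\<lambda>k. a k * t ^ k) sums (\<Prod>i = 1..n. 1 - t * y i) powr - (real m - real p / real n)"
        by (simp add: c_def)
    qed
    also have "(\<Prod>i = 1..n. y i) powr - (real p / real n) = (\<Prod>i = 1..n. y i powr (- real p / real n))"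
      using y_pos by (subst prod_powr_distrib) (auto simp: less_imp_le)
    also have "a p = ?S"
      by (simp add: a_def b_def c_def weak_compositions_def)
    finally show ?thesis by (simp add: mult_ac)
  qed
qed

end
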